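(* In the regulation setting described in the context, assume (A4) and (A5), that $\mathbf{L}$ is continuous at every point of $\mathcal{H}_\mathsf{S}$, that $\mathbf{q}_\infty\in\mathbb{R}^n$ satisfies $\mathbf{f}(\mathbf{q}_\infty)=\mathbf{p}$, and that $\mathrm{rank}((\mathbf{C}_D^T\mathbf{L}\boldsymbol{\Psi})(\mathbf{q}_\infty))=m$. Then $\mathbf{q}_\infty$ is a semistable equilibrium point of $\dot{\mathbf{q}}=\mathbf{u}(\mathbf{q})$. If $m=n$, then $\mathbf{q}_\infty$ is asymptotically stable.
   Context: Setting: $l\ge2$, $m_1,\dots,m_l\ge1$, $m=\sum m_a\le n$. All maps are time-independent and regarded as functions of $\mathbf{q}\in\mathbb{R}^n$: $\mathbf{f}=(\mathbf{f}_1,\dots,\mathbf{f}_l):\mathbb{R}^n\to\mathbb{R}^m$ differentiable with continuous Jacobian $\mathbf{F}_q=\mathsf{D}\mathbf{f}$ (and $\mathbf{f}_t=\mathbf{0}$); $\mathbf{R}:\mathbb{R}^n\to$ invertible $n\times n$ matrices, continuous; $\mathbf{p}=(\mathbf{p}_a)\in\mathbb{R}^m$ constant; $\mathbf{K}=\mathrm{diag}(k_a\mathbf{I}_{m_a})$, $k_a>0$; $\boldsymbol{\Psi}=\mathrm{diag}(\psi_a\mathbf{I}_{m_a})$ with continuous $\psi_a:\mathbb{R}^n\to[0,1]$; $\mathbf{r}'=\boldsymbol{\Psi}\mathbf{K}(\mathbf{p}-\mathbf{f})$; $\mathbf{J}=\mathbf{F}_q\mathbf{R}^{-1}$. Orthogonalization: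 pointwise Gram–Schmidt on rows $\mathbf{j}_i$ of $\mathbf{J}$: $\mathbf{v}_i=\mathbf{j}_i-\sum_{k<i,c_{kk}>0}\langle\hat{\mathbf{j}}_k,\mathbf{j}_i\rangle\hat{\mathbf{j}}_k$, $c_{ii}=\|\mathbf{v}_i\|$, $\hat{\mathbf{j}}_i=\mathbf{v}_i/c_{ii}$ if $c_{ii}>0$, $c_{ik}=\langle\hat{\mathbf{j}}_k,\mathbf{j}_i\rangle$ ($k<i$, $c_{kk}>0$), else $0$; other rows complete an orthonormal basis of the null space of $\mathbf{J}$. $\mathbf{C}=[c_{ik}]_{i,k\le m}$ with blocks $\mathbf{C}_{ab}\in\mathbb{R}^{m_a\times m_b}$, $\mathbf{C}_D=\mathrm{diag}(\mathbf{C}_{aa})$, $\hat{\mathbf{J}}$ = top $m$ rows of the orthogonal matrix. $\mathbf{L}=[\mathbf{L}_{ab}]:\mathbb{R}^n\to\mathbb{R}^{m\times m}$ block lower triangular; $\mathbf{u}=\mathbf{R}^{-1}\hat{\mathbf{J}}^T\mathbf{C}_D^T\mathbf{L}\mathbf{r}'$. $\mathcal{H}_\mathsf{S}=\{\mathbf{q}:\mathrm{rank}\,\mathbf{J}(\mathbf{q})=m\}$. (A4): $\mathbf{L}_{aa}(\mathbf{q})$ symmetric positive semidefinite for all $a,\mathbf{q}$; (A5): $\mathbf{C}_{aa}\mathbf{C}_{aa}^T\mathbf{L}_{aa}=\mathbf{L}_{aa}\mathbf{C}_{aa}\mathbf{C}_{aa}^T$ for all $a$. $S(\mathbf{q}_0)$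 = set of Carathéodory solutions $\mathbf{q}:[0,\infty)\to\mathbb{R}^n$ (absolutely continuous on compact subintervals, $\dot{\mathbf{q}}=\mathbf{u}(\mathbf{q})$ a.e.) with $\mathbf{q}(0)=\mathbf{q}_0$. An equilibrium $\mathbf{q}_\infty$ ($\mathbf{u}(\mathbf{q}_\infty)=\mathbf{0}$) is stable if $\forall\epsilon>0\,\exists\delta>0$ such that for all $\mathbf{q}_0$ with $\|\mathbf{q}_0-\mathbf{q}_\infty\|\le\delta$, $S(\mathbf{q}_0)\ne\emptyset$ and every $\mathbf{q}\in S(\mathbf{q}_0)$ satisfies $\|\mathbf{q}(t)-\mathbf{q}_\infty\|<\epsilon$ for all $t\ge0$; semistable if stable and there is $\delta>0$ such that for all $\mathbf{q}_0$ within $\delta$ of $\mathbf{q}_\infty$, $S(\mathbf{q}_0)\ne\emptyset$ and every $\mathbf{q}\in S(\mathbf{q}_0)$ converges to some stable equilibrium; asymptotically stable if stable and there is $\delta>0$ such that every such solution converges to $\mathbf{q}_\infty$. *)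

theory Defs
  imports "HOL-Analysis.Analysis"
begin

definition abs_continuous_on :: "real \<Rightarrow> real \<Rightarrow> (real \<Rightarrow> 'a::real_normed_vector) \<Rightarrow> bool" where
  "abs_continuous_on a b x \<longleftrightarrow>
     (\<forall>\<epsilon>>0. \<exists>\<delta>>0. \<forall>(N::nat) (s::nat \<Rightarrow> real) (t::nat \<Rightarrow> real).
        (\<forall>i<N. a \<le> s i \<and> s i \<le> t i \<and> t i \<le> b) \<and>
        (\<forall>i<N. \<forall>j<N. i \<noteq> j \<longrightarrow> t i \<le> s j \<or> t j \<le> s i) \<and>
        (\<Sum>i<N. t i - s i) < \<delta>
        \<longrightarrow> (\<Sum>i<N. norm (x (t i) - x (s i))) < \<epsilon>)"

text \<open>Caratheodory solutions on [0,\<infinity>) of x' = u(x) with x(0) = q0 (only the values on [0,\<infinity>) matter).\<close>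
definition cara_solutions :: "('a::euclidean_space \<Rightarrow> 'a) \<Rightarrow> 'a \<Rightarrow> (real \<Rightarrow> 'a) set" where
  "cara_solutions u q0 = {x. x 0 = q0 \<and> (\<forall>T\<ge>0. abs_continuous_on 0 T x) \<and>
       (AE t in lebesgue. 0 \<le> t \<longrightarrow> (x has_vector_derivative u (x t)) (at t))}"

definition equilibrium :: "('a::euclidean_space \<Rightarrow> 'a) \<Rightarrow> 'a \<Rightarrow> bool" where
  "equilibrium u qe \<longleftrightarrow> u qe = 0"

definition stable_eq :: "('a::euclidean_space \<Rightarrow> 'a) \<Rightarrow> 'a \<Rightarrow> bool" where
  "stable_eq u qe \<longleftrightarrow> equilibrium u qe \<and>
     (\<forall>\<epsilon>>0. \<exists>\<delta>>0. \<forall>q0. norm (q0 - qe) \<le> \<delta> \<longrightarrow>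
        cara_solutions u q0 \<noteq> {} \<and>
        (\<forall>x\<in>cara_solutions u q0. \<forall>t\<ge>0. norm (x t - qe) < \<epsilon>))"

definition semistable_eq :: "('a::euclidean_space \<Rightarrow> 'a) \<Rightarrow> 'a \<Rightarrow> bool" where
  "semistable_eq u qe \<longleftrightarrow> stable_eq u qe \<and>
     (\<exists>\<delta>>0. \<forall>q0. norm (q0 - qe) \<le> \<delta> \<longrightarrow>
        cara_solutions u q0 \<noteq> {} \<and>
        (\<forall>x\<in>cara_solutions u q0. \<exists>qs. stable_eq u qs \<and> (x \<longlongrightarrow> qs) at_top))"

definition asymp_stable_eq :: "('a::euclidean_space \<Rightarrow> 'a) \<Rightarrow> 'a \<Rightarrow> bool" where
  "asymp_stable_eq u qe \<longleftrightarrow> stable_eq u qe \<and>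
     (\<exists>\<delta>>0. \<forall>q0. norm (q0 - qe) \<le> \<delta> \<longrightarrow>
        (\<forall>x\<in>cara_solutions u q0. (x \<longlongrightarrow> qe) at_top))"

primrec gs_vs :: "(nat \<Rightarrow> 'a::real_inner) \<Rightarrow> nat \<Rightarrow> 'a list" where
  "gs_vs j 0 = []"
| "gs_vs j (Suc i) = gs_vs j i @
     [j i - (\<Sum>k\<in>{k. k < i \<and> norm (gs_vs j i ! k) > 0}.
               (((gs_vs j i ! k) /\<^sub>R norm (gs_vs j i ! k)) \<bullet> j i) *\<^sub>R
                 ((gs_vs j i ! k) /\<^sub>R norm (gs_vs j i ! k)))]"

definition gs_v :: "(nat \<Rightarrow> 'a::real_inner) \<Rightarrow> nat \<Rightarrow> 'a" where
  "gs_v j i = gs_vs j (Suc i) ! i"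

definition gs_cdiag :: "(nat \<Rightarrow> 'a::real_inner) \<Rightarrow> nat \<Rightarrow> real" where
  "gs_cdiag j i = norm (gs_v j i)"

text \<open>hat j_i = v_i / c_ii if c_ii > 0. If c_ii = 0 the paper takes a unit vector of the null
  space of J; we put 0 there (such rows never influence u, since the corresponding column of C is 0).\<close>
definition gs_hat :: "(nat \<Rightarrow> 'a::real_inner) \<Rightarrow> nat \<Rightarrow> 'a" where
  "gs_hat j i = (if gs_cdiag j i > 0 then gs_v j i /\<^sub>R gs_cdiag j i else 0)"

definition gs_c :: "(nat \<Rightarrow> 'a::real_inner) \<Rightarrow> nat \<Rightarrow> nat \<Rightarrow> real" where
  "gs_c j i k = (if k < i \<and> gs_cdiag j k > 0 then gs_hat j k \<bullet> j i
                 else if k = i then gs_cdiag j i else 0)"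

text \<open>Data: Fq q i = i-th row of the Jacobian of f at q; R q the n x n matrix;
  blk i = index of the block containing row i; kk a = k_a; psi a q = psi_a(q);
  p i, f q i components; L q i k entries of L(q).\<close>

definition Jrow :: "(real^'n \<Rightarrow> nat \<Rightarrow> real^'n) \<Rightarrow> (real^'n \<Rightarrow> real^'n^'n) \<Rightarrow> real^'n \<Rightarrow> nat \<Rightarrow> real^'n" where
  "Jrow Fq R q i = Fq q i v* matrix_inv (R q)"

definition CD :: "(nat \<Rightarrow> nat) \<Rightarrow> (real^'n \<Rightarrow> nat \<Rightarrow> real^'n) \<Rightarrow> (real^'n \<Rightarrow> real^'n^'n) \<Rightarrow> real^'n \<Rightarrow> nat \<Rightarrow> nat \<Rightarrow> real" where
  "CD blk Fq R q i k = (if blk i = blk k then gs_c (Jrow Fq R q) i k else 0)"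

definition rprime :: "(nat \<Rightarrow> nat) \<Rightarrow> (nat \<Rightarrow> real) \<Rightarrow> (nat \<Rightarrow> real^'n \<Rightarrow> real) \<Rightarrow> (nat \<Rightarrow> real) \<Rightarrow> (real^'n \<Rightarrow> nat \<Rightarrow> real) \<Rightarrow> real^'n \<Rightarrow> nat \<Rightarrow> real" where
  "rprime blk kk psi p f q i = psi (blk i) q * kk (blk i) * (p i - f q i)"

definition ctrl_u :: "nat \<Rightarrow> (nat \<Rightarrow> nat) \<Rightarrow> (nat \<Rightarrow> real) \<Rightarrow> (nat \<Rightarrow> real^'n \<Rightarrow> real) \<Rightarrow> (nat \<Rightarrow> real)
     \<Rightarrow> (real^'n \<Rightarrow> nat \<Rightarrow> real) \<Rightarrow> (real^'n \<Rightarrow> nat \<Rightarrow> real^'n) \<Rightarrow> (real^'n \<Rightarrow> real^'n^'n)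
     \<Rightarrow> (real^'n \<Rightarrow> nat \<Rightarrow> nat \<Rightarrow> real) \<Rightarrow> real^'n \<Rightarrow> real^'n" where
  "ctrl_u m blk kk psi p f Fq R L q =
     matrix_inv (R q) *v
       (\<Sum>i<m. (\<Sum>k<m. CD blk Fq R q k i * (\<Sum>j<m. L q k j * rprime blk kk psi p f q j))
                  *\<^sub>R gs_hat (Jrow Fq R q) i)"

definition lin_indep_cols :: "nat \<Rightarrow> (nat \<Rightarrow> nat \<Rightarrow> real) \<Rightarrow> nat set \<Rightarrow> bool" where
  "lin_indep_cols r A S \<longleftrightarrow>
     (\<forall>g::nat \<Rightarrow> real. (\<forall>i<r. (\<Sum>j\<in>S. g j * A i j) = 0) \<longrightarrow> (\<forall>j\<in>S. g j = 0))"

definition mat_rank :: "nat \<Rightarrow> nat \<Rightarrow> (nat \<Rightarrow> nat \<Rightarrow> real) \<Rightarrow> nat" where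
  "mat_rank r c A = Max (card ` {S. S \<subseteq> {..<c} \<and> lin_indep_cols r A S})"

end

theory Submission
  imports Defs "HOL-Complex_Analysis.Great_Picard"
begin

text \<open>Write \<open>e = f - p\<close>. Gram-Schmidt factors the rows of \<open>J\<close> through a lower triangular \<open>C\<close>,
  so along solutions \<open>e' = - M(q) e\<close> with \<open>M = C C\<^sub>D\<^sup>T L \<Psi> K\<close> block lower triangular. The rank condition
  forces all pivots of \<open>C\<close>, all diagonal blocks of \<open>L\<close> and all \<open>\<psi>\<close> to be nondegenerate at the
  target, hence a suitably weighted block-diagonal form of \<open>L\<close> at the target gives a quadratic
  Lyapunov function \<open>V\<close> of \<open>e\<close> with \<open>V' \<le> - 2 c V\<close> and \<open>|u| \<le> K \<surd>V\<close> nearby. Trajectories then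
  have length at most \<open>K \<surd>V(q\<^sub>0) / c\<close>, so they stay close, exist for all time and converge to zeros
  of \<open>V\<close>; each nearby zero satisfies the same estimates and is therefore stable. If \<open>m = n\<close> the
  zero is isolated.\<close>

section \<open>Absolute continuity and the fundamental theorem of calculus\<close>

text \<open>The field \<open>u\<close> is tame only near the target: Gram-Schmidt can jump where a
  pivot vanishes, and \<open>L\<close> is continuous only where \<open>J\<close> has full rank. Even
  there \<open>u\<close> is merely continuous, so solutions need not be unique, and every claim has
  to hold for all of them. A Caratheodory solution brings only an almost everywhere derivative; the
  fundamental theorem for absolutely continuous curves turns it into a genuine derivative as long as
  the curve stays where \<open>u\<close> is continuous. Existence comes from Peano's theorem for a
  bounded continuous field that agrees with \<open>u\<close> on a small ball which its solutions
  never leave. For \<open>m < n\<close> the equilibria need not be isolated: \<open>V\<close>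
  vanishes on the whole set \<open>f = p\<close>, so its sublevel sets do not confine a trajectory
  to the neighbourhood of a point. This is why the argument runs through the length of
  trajectories.\<close>

lemma abs_continuous_on_finite_family:
  fixes x :: "real \<Rightarrow> 'a::real_normed_vector"
  assumes "abs_continuous_on a b x" and "e > 0"
  shows "\<exists>d>0. \<forall>(I::'i set) s t. finite I \<longrightarrow> (\<forall>i\<in>I. a \<le> s i \<and> s i \<le> t i \<and> t i \<le> b) \<longrightarrow>
           (\<forall>i\<in>I. \<forall>j\<in>I. i \<noteq> j \<longrightarrow> t i \<le> s j \<or> t j \<le> s i) \<longrightarrow>
           (\<Sum>i\<in>I. t i - s i) < d \<longrightarrow> (\<Sum>i\<in>I. norm (x (t i) - x (s i))) < e"
proof -
  obtain d where d: "d > 0" and D: "\<forall>(N::nat) (s::nat \<Rightarrow> real) t.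
        (\<forall>i<N. a \<le> s i \<and> s i \<le> t i \<and> t i \<le> b) \<and>
        (\<forall>i<N. \<forall>j<N. i \<noteq> j \<longrightarrow> t i \<le> s j \<or> t j \<le> s i) \<and>
        (\<Sum>i<N. t i - s i) < d
        \<longrightarrow> (\<Sum>i<N. norm (x (t i) - x (s i))) < e"
    using assms(1)[unfolded abs_continuous_on_def, THEN spec, THEN mp, OF assms(2)] by (elim exE conjE)
  show ?thesis
  proof (intro exI[of _ d] conjI d allI impI)
    fix I :: "'i set" and s t :: "'i \<Rightarrow> real"
    assume fin: "finite I" and 1: "\<forall>i\<in>I. a \<le> s i \<and> s i \<le> t i \<and> t i \<le> b"
      and 2: "\<forall>i\<in>I. \<forall>j\<in>I. i \<noteq> j \<longrightarrow> t i \<le> s j \<or> t j \<le> s i"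
      and 3: "(\<Sum>i\<in>I. t i - s i) < d"
    obtain h where h: "bij_betw h {..<card I} I"
      using ex_bij_betw_nat_finite[OF fin] atLeast0LessThan by auto
    have hI: "h i \<in> I" if "i < card I" for i
      using h that by (auto simp: bij_betw_def)
    have hne: "h i \<noteq> h j" if "i < card I" "j < card I" "i \<noteq> j" for i j
      using h that by (auto simp: bij_betw_def inj_on_def)
    have "(\<Sum>i<card I. norm (x (t (h i)) - x (s (h i)))) < e"
    proof (rule D[THEN spec, THEN spec, THEN spec, THEN mp], intro conjI)
      show "(\<Sum>i<card I. t (h i) - s (h i)) < d"
        using 3 sum.reindex_bij_betw[OF h, of "\<lambda>i. t i - s i"] by simp
      show "\<forall>i<card I. a \<le> s (h i) \<and> s (h i) \<le> t (h i) \<and> t (h i) \<le> b" using 1 hI by simp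
      show "\<forall>i<card I. \<forall>j<card I. i \<noteq> j \<longrightarrow> t (h i) \<le> s (h j) \<or> t (h j) \<le> s (h i)"
        using 2 hI hne by simp
    qed
    then show "(\<Sum>i\<in>I. norm (x (t i) - x (s i))) < e"
      using sum.reindex_bij_betw[OF h, of "\<lambda>i. norm (x (t i) - x (s i))"] by simp
  qed
qed

lemma abs_continuous_on_imp_continuous_on:
  fixes x :: "real \<Rightarrow> 'a::real_normed_vector"
  assumes "abs_continuous_on a b x"
  shows "continuous_on {a..b} x"
  unfolding continuous_on_iff
proof (intro ballI allI impI)
  fix t and e :: real assume t: "t \<in> {a..b}" and e: "e > 0"
  obtain d where d: "d > 0" and D: "\<forall>(N::nat) (s::nat \<Rightarrow> real) t.
        (\<forall>i<N. a \<le> s i \<and> s i \<le> t i \<and> t i \<le> b) \<and>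
        (\<forall>i<N. \<forall>j<N. i \<noteq> j \<longrightarrow> t i \<le> s j \<or> t j \<le> s i) \<and>
        (\<Sum>i<N. t i - s i) < d
        \<longrightarrow> (\<Sum>i<N. norm (x (t i) - x (s i))) < e"
    using assms(1)[unfolded abs_continuous_on_def, THEN spec, THEN mp, OF e] by (elim exE conjE)
  show "\<exists>d>0. \<forall>r\<in>{a..b}. dist r t < d \<longrightarrow> dist (x r) (x t) < e"
  proof (intro exI[of _ d] conjI ballI impI d)
    fix r assume r: "r \<in> {a..b}" "dist r t < d"
    \<comment> \<open>A family with a single interval suffices, from \<open>min r t\<close> to
      \<open>max r t\<close>.\<close>
    show "dist (x r) (x t) < e"
      using D[THEN spec[of _ 1], THEN spec[of _ "\<lambda>_. min r t"], THEN spec[of _ "\<lambda>_. max r t"]] r t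
      by (cases "r \<le> t") (auto simp: dist_norm norm_minus_commute)
  qed
qed

lemma lipschitz_imp_abs_continuous_on:
  fixes x :: "real \<Rightarrow> 'a::real_normed_vector"
  assumes lip: "\<And>s t. a \<le> s \<Longrightarrow> s \<le> t \<Longrightarrow> t \<le> b \<Longrightarrow> norm (x t - x s) \<le> B * (t - s)"
  shows "abs_continuous_on a b x"
  unfolding abs_continuous_on_def
proof (intro allI impI)
  fix e :: real assume e: "e > 0"
  show "\<exists>\<delta>>0. \<forall>(N::nat) s t.
        (\<forall>i<N. a \<le> s i \<and> s i \<le> t i \<and> t i \<le> b) \<and>
        (\<forall>i<N. \<forall>j<N. i \<noteq> j \<longrightarrow> t i \<le> s j \<or> t j \<le> s i) \<and>
        (\<Sum>i<N. t i - s i) < \<delta>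
        \<longrightarrow> (\<Sum>i<N. norm (x (t i) - x (s i))) < e"
  \<comment> \<open>The constant \<open>B\<close> may be 0 or negative, hence the absolute value and
    the \<open>+ 1\<close>.\<close>
  proof (intro exI[of _ "e / (\<bar>B\<bar> + 1)"] conjI allI impI)
    show "e / (\<bar>B\<bar> + 1) > 0" using e by simp
    fix N :: nat and s t :: "nat \<Rightarrow> real"
    assume *: "(\<forall>i<N. a \<le> s i \<and> s i \<le> t i \<and> t i \<le> b) \<and>
        (\<forall>i<N. \<forall>j<N. i \<noteq> j \<longrightarrow> t i \<le> s j \<or> t j \<le> s i) \<and>
        (\<Sum>i<N. t i - s i) < e / (\<bar>B\<bar> + 1)"
    have "(\<Sum>i<N. norm (x (t i) - x (s i))) \<le> (\<Sum>i<N. (\<bar>B\<bar> + 1) * (t i - s i))"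
    proof (rule sum_mono)
      fix i assume "i \<in> {..<N}"
      then have i: "a \<le> s i" "s i \<le> t i" "t i \<le> b" using * by blast+
      have "B * (t i - s i) \<le> (\<bar>B\<bar> + 1) * (t i - s i)"
        using i by (intro mult_right_mono) auto
      with lip[OF i] show "norm (x (t i) - x (s i)) \<le> (\<bar>B\<bar> + 1) * (t i - s i)" by simp
    qed
    also have "\<dots> = (\<bar>B\<bar> + 1) * (\<Sum>i<N. t i - s i)" by (simp add: sum_distrib_left)
    also have "\<dots> < e"
    proof -
      have "(\<Sum>i<N. t i - s i) < e / (\<bar>B\<bar> + 1)" using * by blast
      then show ?thesis by (simp add: pos_less_divide_eq mult.commute)
    qed
    finally show "(\<Sum>i<N. norm (x (t i) - x (s i))) < e" .
  qed
qed

text \<open>Outer regularity makes \<open>U - N\<close> small; adding back the null set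
  \<open>N\<close> does not change the measure.\<close>

lemma negligible_open_cover:
  fixes N :: "'a::euclidean_space set"
  assumes "negligible N" "e > 0"
  obtains U where "open U" "N \<subseteq> U" "U \<in> lmeasurable" "measure lebesgue U < e"
proof -
  have N: "N \<in> sets lebesgue" using assms by (simp add: negligible_imp_sets)
  obtain U where U: "open U" "N \<subseteq> U" "U - N \<in> lmeasurable" "emeasure lebesgue (U - N) < ennreal e"
    using sets_lebesgue_outer_open[OF N \<open>e > 0\<close>] by blast
  have "U = (U - N) \<union> N" using U by blast
  then have meas: "U \<in> lmeasurable"
    using U(3) assms negligible_imp_measurable by (metis fmeasurable.Un)
  have "measure lebesgue U = measure lebesgue (U - N)"
    using measure_negligible_symdiff[of "U-N" U] assms U(3)
    by (metis Diff_eq_empty_iff Un_Diff_cancel2 \<open>U = U - N \<union> N\<close> double_diff fmeasurableD inf_sup_ord(3) negligible_Un_eq negligible_empty sup_bot.left_neutral U(2) Diff_subset)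
  also have "\<dots> < e"
    using U(3,4) assms(2) by (simp add: emeasure_eq_measure2 ennreal_less_iff)
  finally show ?thesis using that U meas by blast
qed

text \<open>A Henstock gauge argument: tags outside the exceptional null set are controlled by
  differentiability, tags inside it by absolute continuity, since their intervals lie in an open
  set of small measure.\<close>
theorem abs_continuous_on_has_integral_deriv:
  fixes x :: "real \<Rightarrow> 'a::banach"
  assumes ac: "abs_continuous_on a b x" and ab: "a \<le> b" and N: "negligible N"
    and der: "\<And>t. t \<in> {a..b} - N \<Longrightarrow> (x has_vector_derivative g t) (at t within {a..b})"
  shows "(g has_integral (x b - x a)) {a..b}"
proof (rule has_integral_spike[OF N])
  \<comment> \<open>At tags in \<open>N\<close> the value of \<open>g\<close> is arbitrary.
    Replacing it by 0 leaves only increments of \<open>x\<close> there, which absolute continuity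
    controls.\<close>
  define h where "h t = (if t \<in> N then 0 else g t)" for t
  show "\<And>t. t \<in> {a..b} - N \<Longrightarrow> g t = h t" by (auto simp: h_def)
  show "(h has_integral (x b - x a)) {a..b}"
    unfolding has_integral_real
  proof (intro allI impI)
    fix e0 :: real assume e0: "e0 > 0"
    \<comment> \<open>One half of \<open>e0\<close> is spread over the whole length for the tags
      outside \<open>N\<close>, the other half is kept for the tags inside; the \<open>+ 1\<close>
      covers \<open>a = b\<close>.\<close>
    define e where "e = e0 / 2 / (b - a + 1)"
    have e: "e > 0" using e0 ab by (simp add: e_def)
    obtain \<delta> where \<delta>: "\<delta> > 0"
      and \<delta>D: "\<forall>(I::(real \<times> real set) set) s t. finite I \<longrightarrow> (\<forall>i\<in>I. a \<le> s i \<and> s i \<le> t i \<and> t i \<le> b) \<longrightarrow>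
           (\<forall>i\<in>I. \<forall>j\<in>I. i \<noteq> j \<longrightarrow> t i \<le> s j \<or> t j \<le> s i) \<longrightarrow>
           (\<Sum>i\<in>I. t i - s i) < \<delta> \<longrightarrow> (\<Sum>i\<in>I. norm (x (t i) - x (s i))) < e0 / 2"
      using abs_continuous_on_finite_family[OF ac half_gt_zero[OF e0]] by (elim exE conjE)
    obtain U where U: "open U" "N \<subseteq> U" "U \<in> lmeasurable" "measure lebesgue U < \<delta>"
      using negligible_open_cover[OF N \<delta>] by blast
    have "\<forall>t. \<exists>d>0. t \<in> {a..b} - N \<longrightarrow>
         (\<forall>y\<in>{a..b}. norm (y-t) < d \<longrightarrow> norm (x y - x t - (y-t) *\<^sub>R g t) \<le> e * norm (y-t))"
      using der[unfolded has_vector_derivative_def has_derivative_within_alt] e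
      by (metis zero_less_one)
    then obtain d where d: "\<And>t. 0 < d t"
                 "\<And>t y. \<lbrakk>t \<in> {a..b} - N; y \<in> {a..b}; norm (y-t) < d t\<rbrakk>
                        \<Longrightarrow> norm (x y - x t - (y-t) *\<^sub>R g t) \<le> e * norm (y-t)"
      by metis
    have "\<forall>t. \<exists>r>0. t \<in> N \<longrightarrow> ball t r \<subseteq> U"
      using U(1,2) by (meson open_contains_ball subsetD zero_less_one)
    then obtain r where r: "\<And>t. 0 < r t" "\<And>t. t \<in> N \<Longrightarrow> ball t (r t) \<subseteq> U" by metis
    define \<gamma> where "\<gamma> t = ball t (if t \<in> N then r t else d t)" for t
    show "\<exists>\<gamma>. gauge \<gamma> \<and> (\<forall>p. p tagged_division_of {a..b} \<and> \<gamma> fine p \<longrightarrow>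
            norm ((\<Sum>(t, K)\<in>p. measure lborel K *\<^sub>R h t) - (x b - x a)) < e0)"
    proof (intro exI[of _ \<gamma>] conjI allI impI)
      show "gauge \<gamma>"
        unfolding \<gamma>_def using d(1) r(1) by (intro gauge_ball_dependent) auto
      fix p assume "p tagged_division_of {a..b} \<and> \<gamma> fine p"
      then have p: "p tagged_division_of {a..b}" and fine: "\<gamma> fine p" by auto
      have ba: "b - a = (\<Sum>(t,K)\<in>p. Sup K - Inf K)" "x b - x a = (\<Sum>(t,K)\<in>p. x(Sup K) - x(Inf K))"
        using additive_tagged_division_1[OF ab p, of "\<lambda>t. t"] additive_tagged_division_1[OF ab p, of x]
        by auto
      have finp: "finite p" using p by blast
      have ivl: "K = {Inf K..Sup K}"
        and bnd: "Inf K \<le> t \<and> t \<le> Sup K \<and> a \<le> Inf K \<and> Sup K \<le> b \<and>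
          measure lborel K = Sup K - Inf K \<and> measure lebesgue K = Sup K - Inf K \<and> Inf K \<in> K \<and> Sup K \<in> K"
        if "(t,K) \<in> p" for t K
      proof -
        obtain u v where K: "K = cbox u v" using p \<open>(t,K) \<in> p\<close> by blast
        have "t \<in> K" "K \<subseteq> {a..b}" using p that by blast+
        then show "K = {Inf K..Sup K}" "Inf K \<le> t \<and> t \<le> Sup K \<and> a \<le> Inf K \<and> Sup K \<le> b \<and>
          measure lborel K = Sup K - Inf K \<and> measure lebesgue K = Sup K - Inf K \<and> Inf K \<in> K \<and> Sup K \<in> K"
          using K by auto
      qed
      \<comment> \<open>Intervals of length zero are left out: they contribute nothing, and disjoint
        interiors force an order only between nondegenerate intervals.\<close>
      define P where "P = {z\<in>p. fst z \<in> N \<and> Inf (snd z) < Sup (snd z)}"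
      have finP: "finite P" using finp by (simp add: P_def)
      have Pp: "P \<subseteq> p" by (auto simp: P_def)
      have order: "Sup (snd i) \<le> Inf (snd j) \<or> Sup (snd j) \<le> Inf (snd i)"
        if ij: "i \<in> P" "j \<in> P" "i \<noteq> j" for i j
      proof (rule ccontr)
        assume c: "\<not> ?thesis"
        obtain ti Ki tj Kj where ij': "i = (ti,Ki)" "j = (tj,Kj)" by fastforce
        then have m: "(ti,Ki) \<in> p" "(tj,Kj) \<in> p" "(ti,Ki) \<noteq> (tj,Kj)" using ij Pp by auto
        then have "interior Ki \<inter> interior Kj = {}" using p by (metis tagged_division_ofD(5))
        moreover have "interior Ki = {Inf Ki<..<Sup Ki}" "interior Kj = {Inf Kj<..<Sup Kj}"
          using ivl m by (metis interior_atLeastAtMost_real)+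
        moreover have "Inf Ki < Sup Ki" "Inf Kj < Sup Kj" using ij ij' by (auto simp: P_def)
        ultimately have "{max (Inf Ki) (Inf Kj)<..<min (Sup Ki) (Sup Kj)} = {}" by auto
        then have "\<not> max (Inf Ki) (Inf Kj) < min (Sup Ki) (Sup Kj)"
          by (metis greaterThanLessThan_empty_iff2 not_le)
        with c ij' \<open>Inf Ki < Sup Ki\<close> \<open>Inf Kj < Sup Kj\<close> show False by (auto simp: min_def max_def split: if_splits)
      qed
      \<comment> \<open>The intervals overlap at most in endpoints, so their total length is the
        measure of their union, which the gauge places inside \<open>U\<close>.\<close>
      have "(\<Sum>i\<in>P. Sup (snd i) - Inf (snd i)) = (\<Sum>i\<in>P. measure lebesgue (snd i))"
        using bnd Pp by (intro sum.cong refl) (force simp: subset_iff)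
      also have "\<dots> = measure lebesgue (\<Union>(snd ` P))"
      proof (rule measure_negligible_finite_Union_image[symmetric, OF finP])
        show "snd i \<in> lmeasurable" if "i \<in> P" for i
          using ivl[of "fst i" "snd i"] that Pp
          by (metis lmeasurable_cbox box_real(2) prod.collapse subsetD)
        show "pairwise (\<lambda>i j. negligible (snd i \<inter> snd j)) P"
        proof (rule pairwiseI)
          fix i j assume ij: "i \<in> P" "j \<in> P" "i \<noteq> j"
          have "snd i = {Inf (snd i)..Sup (snd i)}" "snd j = {Inf (snd j)..Sup (snd j)}"
            using ivl ij Pp by (metis prod.collapse subsetD)+
          then have "snd i \<inter> snd j \<subseteq> {Sup (snd i), Sup (snd j)}"
            using order[OF ij] by (smt (verit) IntE atLeastAtMost_iff insert_iff subsetI)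
          then show "negligible (snd i \<inter> snd j)"
            by (meson finite.emptyI finite.insertI negligible_finite negligible_subset)
        qed
      qed
      also have "\<dots> \<le> measure lebesgue U"
      proof (rule measure_mono_fmeasurable)
        show "\<Union>(snd ` P) \<subseteq> U"
        proof
          fix s assume "s \<in> \<Union>(snd ` P)"
          then obtain t K where tK: "(t,K) \<in> P" "s \<in> K" by auto
          then have "K \<subseteq> \<gamma> t" "t \<in> N" using fine Pp by (auto simp: fine_def P_def)
          then show "s \<in> U" using r(2) tK by (auto simp: \<gamma>_def)
        qed
        show "\<Union>(snd ` P) \<in> sets lebesgue"
        proof (intro sets.finite_UN finP)
          fix i assume "i \<in> P"
          then have "snd i = cbox (Inf (snd i)) (Sup (snd i))"
            using ivl[of "fst i" "snd i"] Pp by (metis box_real(2) prod.collapse subsetD)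
          then show "snd i \<in> sets lebesgue"
            by (metis fmeasurableD lmeasurable_cbox)
        qed
      qed (use U in auto)
      finally have len: "(\<Sum>i\<in>P. Sup (snd i) - Inf (snd i)) < \<delta>" using U(4) by simp
      have small: "(\<Sum>i\<in>P. norm (x (Sup (snd i)) - x (Inf (snd i)))) < e0 / 2"
      proof (rule \<delta>D[THEN spec, THEN spec, THEN spec, THEN mp, THEN mp, THEN mp, THEN mp, OF finP _ _ len];
          intro ballI impI)
        fix i assume "i \<in> P"
        then have "(fst i, snd i) \<in> p" using Pp by auto
        from bnd[OF this] show "a \<le> Inf (snd i) \<and> Inf (snd i) \<le> Sup (snd i) \<and> Sup (snd i) \<le> b"
          by auto
      next
        fix i j assume "i \<in> P" "j \<in> P" "i \<noteq> j"
        then show "Sup (snd i) \<le> Inf (snd j) \<or> Sup (snd j) \<le> Inf (snd i)" by (rule order)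
      qed
      have straddle: "norm (measure lborel K *\<^sub>R h t - (x (Sup K) - x (Inf K))) \<le> e * (Sup K - Inf K)"
        if tK: "(t,K) \<in> p" "t \<notin> N" for t K
      proof -
        note I = bnd[OF tK(1)]
        have "K \<subseteq> \<gamma> t" using fine tK by (auto simp: fine_def)
        moreover have "Inf K \<in> K" "Sup K \<in> K" using I by blast+
        ultimately have "norm (Inf K - t) < d t" "norm (Sup K - t) < d t"
          using tK by (auto simp: \<gamma>_def dist_real_def subset_iff)
        then have 1: "norm (x (Inf K) - x t - (Inf K - t) *\<^sub>R g t) \<le> e * norm (Inf K - t)"
          and 2: "norm (x (Sup K) - x t - (Sup K - t) *\<^sub>R g t) \<le> e * norm (Sup K - t)"
          using I tK(2) by (intro d(2); auto)+
        \<comment> \<open>Straddle estimate: the increment is split at the tag \<open>t\<close>,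
          which lies in \<open>K\<close>, so the two errors add up to \<open>e\<close> times the
          length.\<close>
        have "norm (measure lborel K *\<^sub>R h t - (x (Sup K) - x (Inf K)))
          = norm ((x (Inf K) - x t - (Inf K - t) *\<^sub>R g t) - (x (Sup K) - x t - (Sup K - t) *\<^sub>R g t))"
          using tK(2) by (simp add: h_def I[THEN conjunct2, THEN conjunct2, THEN conjunct2, THEN conjunct2, THEN conjunct1] algebra_simps)
        also have "\<dots> \<le> e * norm (Inf K - t) + e * norm (Sup K - t)"
          by (rule order_trans[OF norm_triangle_ineq4 add_mono[OF 1 2]])
        also have "\<dots> = e * (Sup K - Inf K)"
          using I by (simp add: algebra_simps)
        finally show ?thesis .
      qed
      have "norm ((\<Sum>(t, K)\<in>p. measure lborel K *\<^sub>R h t) - (x b - x a))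
         = norm (\<Sum>z\<in>p. measure lborel (snd z) *\<^sub>R h (fst z) - (x (Sup (snd z)) - x (Inf (snd z))))"
        by (simp add: ba split_def sum_subtractf)
      also have "\<dots> \<le> (\<Sum>z\<in>p. e * (Sup (snd z) - Inf (snd z))
           + (if z \<in> P then norm (x (Sup (snd z)) - x (Inf (snd z))) else 0))"
      proof (rule sum_norm_le)
        fix z assume z: "z \<in> p"
        obtain t K where tK: "z = (t,K)" by fastforce
        note I = bnd[OF z[unfolded tK]]
        have K: "measure lborel K = Sup K - Inf K" "Inf K \<le> Sup K" using I by linarith+
        have pos: "0 \<le> e * (Sup K - Inf K)" using e K by simp
        show "norm (measure lborel (snd z) *\<^sub>R h (fst z) - (x (Sup (snd z)) - x (Inf (snd z))))
            \<le> e * (Sup (snd z) - Inf (snd z))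
              + (if z \<in> P then norm (x (Sup (snd z)) - x (Inf (snd z))) else 0)"
        proof (cases "t \<in> N")
          case False
          then have "z \<notin> P" by (simp add: P_def tK)
          then show ?thesis using straddle[of t K] False z tK by simp
        next
          case True
          then have ht: "h t = 0" by (simp add: h_def)
          show ?thesis
          proof (cases "Inf K < Sup K")
            case less: True
            then have "z \<in> P" using True z by (simp add: P_def tK)
            then show ?thesis using pos by (simp add: tK ht norm_minus_commute)
          next
            case False
            then have "Inf K = Sup K" using K by simp
            then show ?thesis by (simp add: tK ht)
          qed
        qed
      qed
      also have "\<dots> = e * (b - a) + (\<Sum>i\<in>P. norm (x (Sup (snd i)) - x (Inf (snd i))))"
        using sum.inter_restrict[OF finp, of "\<lambda>i. norm (x (Sup (snd i)) - x (Inf (snd i)))" P] Pp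
        by (simp add: sum.distrib ba(1) split_def sum_distrib_left Int_absorb1)
      also have "\<dots> < e0 / 2 + e0 / 2"
      proof (rule add_le_less_mono[OF _ small])
        show "e * (b - a) \<le> e0 / 2"
          using ab e0 by (simp add: e_def field_simps)
      qed
      finally show "norm ((\<Sum>(t, K)\<in>p. measure lborel K *\<^sub>R h t) - (x b - x a)) < e0" by simp
    qed
  qed
qed

section \<open>Peano existence on the half-line\<close>

text \<open>Negative times are included because a delayed argument starts below 0; there
  \<open>{0..t}\<close> is empty and the integral is 0.\<close>

lemma integral_from_0_lipschitz:
  fixes g :: "real \<Rightarrow> 'a::banach"
  assumes cont: "continuous_on UNIV g" and bnd: "\<And>s. norm (g s) \<le> B"
  shows "norm (integral {0..t} g - integral {0..s} g) \<le> B * \<bar>t - s\<bar>"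
proof -
  have B: "0 \<le> B" using bnd[of 0] norm_ge_zero order_trans by blast
  have int: "g integrable_on {a..b}" for a b
    using cont continuous_on_subset integrable_continuous_real by blast
  have neg: "integral {0..s} g = integral {0..max s 0} g" for s :: real
    by (cases s "0::real" rule: linorder_cases) (auto simp: max_def)
  have pos: "norm (integral {0..t} g - integral {0..s} g) \<le> B * (t - s)" if "0 \<le> s" "s \<le> t" for s t :: real
  proof -
    have "integral {0..t} g - integral {0..s} g = integral {s..t} g"
      using Henstock_Kurzweil_Integration.integral_combine[OF that int] by (simp add: algebra_simps)
    also have "norm \<dots> \<le> B * (t - s)"
      using integral_bound[of s t g B] that bnd continuous_on_subset[OF cont] by auto
    finally show ?thesis .
  qed
  have "norm (integral {0..t} g - integral {0..s} g) \<le> B * (max t 0 - max s 0)" if "s \<le> t" for s t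
    by (subst (1 2) neg) (intro pos; use that in auto)
  then have 1: "norm (integral {0..t} g - integral {0..s} g) \<le> B * (t - s)" if "s \<le> t" for s t
    using that B by (smt (verit) mult_left_mono)
  show ?thesis
  proof (cases "s \<le> t")
    case True
    then show ?thesis using 1[of s t] by simp
  next
    case False
    then show ?thesis using 1[of t s] by (simp add: norm_minus_commute)
  qed
qed

text \<open>Peano's theorem by Tonelli's method: the equation with delay \<open>h\<close> is solved exactly by
  iteration, because each iterate is already final on an interval longer by \<open>h\<close>. The delayed
  solutions are equi-Lipschitz, so convergence of a subsequence at rational times suffices.\<close>

primrec delay_iter :: "('a::euclidean_space \<Rightarrow> 'a) \<Rightarrow> 'a \<Rightarrow> real \<Rightarrow> nat \<Rightarrow> real \<Rightarrow> 'a" where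
  "delay_iter u q0 h 0 = (\<lambda>t. q0)"
| "delay_iter u q0 h (Suc k) = (\<lambda>t. q0 + integral {0..t} (\<lambda>s. u (delay_iter u q0 h k (s - h))))"

lemma delay_iter_0 [simp]: "delay_iter u q0 h k 0 = q0"
  by (cases k) auto

lemma delay_iter_lipschitz:
  fixes u :: "'a::euclidean_space \<Rightarrow> 'a"
  assumes cont: "continuous_on UNIV u" and bnd: "\<And>y. norm (u y) \<le> B"
  shows "norm (delay_iter u q0 h k t - delay_iter u q0 h k s) \<le> B * \<bar>t - s\<bar>"
proof (induction k arbitrary: s t)
  case 0
  have "0 \<le> B" using bnd[of 0] norm_ge_zero order_trans by blast
  then show ?case by simp
next
  case (Suc k)
  have "continuous_on UNIV (delay_iter u q0 h k)"
  proof (rule lipschitz_on_continuous_on[of B], rule lipschitz_onI)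
    show "0 \<le> B" using bnd[of 0] norm_ge_zero order_trans by blast
  qed (use Suc in \<open>simp add: dist_norm\<close>)
  then have "continuous_on UNIV (\<lambda>s. delay_iter u q0 h k (s - h))"
    by (rule continuous_on_compose2) (auto intro!: continuous_intros)
  then have "continuous_on UNIV (\<lambda>s. u (delay_iter u q0 h k (s - h)))"
    by (rule continuous_on_compose2[OF cont]) auto
  from integral_from_0_lipschitz[OF this bnd, of t s] show ?case by simp
qed

lemma delay_iter_stationary:
  assumes "h > 0" "t \<le> real k * h"
  shows "delay_iter u q0 h (Suc k) t = delay_iter u q0 h k t"
  using assms(2)
proof (induction k arbitrary: t)
  case 0
  then show ?case by (cases "t = 0") auto
next
  case (Suc k)
  have "integral {0..t} (\<lambda>s. u (delay_iter u q0 h (Suc k) (s - h)))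
      = integral {0..t} (\<lambda>s. u (delay_iter u q0 h k (s - h)))"
  proof (rule integral_cong)
    fix s assume "s \<in> {0..t}"
    then have "s - h \<le> real k * h" using Suc.prems by (simp add: algebra_simps)
    then show "u (delay_iter u q0 h (Suc k) (s - h)) = u (delay_iter u q0 h k (s - h))"
      using Suc.IH by presburger
  qed
  then show ?case by simp
qed

text \<open>The global bound excludes blow-up and yields solutions on the whole half-line;
  \<open>local_behaviour\<close> secures it by composing the field with a projection.\<close>

theorem peano_existence:
  fixes u :: "'a::euclidean_space \<Rightarrow> 'a"
  assumes cont: "continuous_on UNIV u" and bnd: "\<And>y. norm (u y) \<le> B"
  shows "cara_solutions u q0 \<noteq> {}"
proof -
  have B: "0 \<le> B" using bnd[of 0] norm_ge_zero order_trans by blast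
  define h where "h n = 1 / (real n + 1)" for n :: nat
  \<comment> \<open>With step \<open>1 / (n+1)\<close>, this many iterations make the delayed
    equation exact up to time \<open>n+1\<close>, hence eventually on every bounded
    interval.\<close>
  define X where "X n = delay_iter u q0 (h n) ((n+1)*(n+1))" for n
  have h: "h n > 0" for n by (simp add: h_def)
  have lip: "norm (X n t - X n s) \<le> B * \<bar>t - s\<bar>" for n s t
    unfolding X_def by (rule delay_iter_lipschitz[OF cont bnd])
  have X0: "X n 0 = q0" for n by (simp add: X_def)
  have Xeq: "X n t = q0 + integral {0..t} (\<lambda>s. u (X n (s - h n)))" if "t \<le> real n + 1" for n t
  proof -
    have "real ((n+1)*(n+1)) * h n = real n + 1" by (simp add: h_def field_simps)
    then have "X n t = delay_iter u q0 (h n) (Suc ((n+1)*(n+1))) t"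
      unfolding X_def using delay_iter_stationary[OF h] that by metis
    then show ?thesis by (simp add: X_def)
  qed
  have Xcont: "continuous_on S (X n)" for n S
    by (rule lipschitz_on_continuous_on[of B], rule lipschitz_onI) (use lip B in \<open>auto simp: dist_norm\<close>)
  \<comment> \<open>The diagonal argument asks for one bound valid at all times. Dividing by
    \<open>1 + t\<close> provides it, since \<open>X n\<close> grows at most linearly.\<close>
  obtain k where k: "strict_mono (k::nat\<Rightarrow>nat)"
    and conv: "\<And>t. t \<in> {t\<in>\<rat>. 0 \<le> t} \<Longrightarrow> \<exists>l. (\<lambda>n. (X (k n) t - q0) /\<^sub>R (1 + t)) \<longlonglongrightarrow> l"
  proof (rule function_convergent_subsequence[of "{t\<in>\<rat>. 0 \<le> t}" "\<lambda>n t. (X n t - q0) /\<^sub>R (1 + t)" B])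
    show "countable {t \<in> \<rat>. 0 \<le> (t::real)}"
      by (rule countable_subset[OF _ countable_rat]) auto
    fix n t assume "t \<in> {t\<in>\<rat>. 0 \<le> (t::real)}"
    then have t: "0 \<le> t" by simp
    have "norm (X n t - q0) \<le> B * t" using lip[of n t 0] t by (simp add: X0)
    also have "\<dots> \<le> B * (1 + t)" using B by (simp add: mult_left_mono)
    finally show "norm ((X n t - q0) /\<^sub>R (1 + t)) \<le> B"
      using t by (simp add: divide_inverse_commute[symmetric] pos_divide_le_eq)
  qed blast
  have conv_rat: "Cauchy (\<lambda>n. X (k n) t)" if t: "t \<in> \<rat>" "0 \<le> t" for t
  proof -
    obtain l where "(\<lambda>n. (X (k n) t - q0) /\<^sub>R (1 + t)) \<longlonglongrightarrow> l" using conv t by blast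
    then have "(\<lambda>n. (1 + t) *\<^sub>R ((X (k n) t - q0) /\<^sub>R (1 + t)) + q0) \<longlonglongrightarrow> (1 + t) *\<^sub>R l + q0"
      by (intro tendsto_intros)
    moreover have "(\<lambda>n. (1 + t) *\<^sub>R ((X (k n) t - q0) /\<^sub>R (1 + t)) + q0) = (\<lambda>n. X (k n) t)"
      using t by auto
    ultimately show ?thesis using LIMSEQ_imp_Cauchy by metis
  qed
  have "convergent (\<lambda>n. X (k n) t)" if t: "0 \<le> t" for t
  proof (rule Cauchy_convergent, rule metric_CauchyI)
    fix e :: real assume e: "e > 0"
    \<comment> \<open>Convergence is known at rational times only; \<open>r\<close> is so close to
      \<open>t\<close> that no \<open>X n\<close> moves by \<open>e / 3\<close> in between.\<close>
    obtain r where r: "r \<in> \<rat>" "t < r" "r < t + e / (3 * (B + 1))"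
      using Rats_dense_in_real[of t "t + e / (3 * (B + 1))"] e B by auto
    have "B * (r - t) \<le> (B + 1) * (r - t)" using r by (simp add: mult_right_mono)
    also have "\<dots> < e / 3"
    proof -
      have "r - t < e / (3 * (B + 1))" using r by simp
      then show ?thesis using B by (simp add: field_simps)
    qed
    finally have Br: "B * (r - t) < e / 3" .
    have near: "dist (X n r) (X n t) < e / 3" for n
      using lip[of n r t] Br r by (simp add: dist_norm)
    obtain M where M: "\<And>m n. m \<ge> M \<Longrightarrow> n \<ge> M \<Longrightarrow> dist (X (k m) r) (X (k n) r) < e / 3"
      using metric_CauchyD[OF conv_rat[of r], of "e/3"] r t e by auto
    show "\<exists>M. \<forall>m\<ge>M. \<forall>n\<ge>M. dist (X (k m) t) (X (k n) t) < e"
    proof (intro exI[of _ M] allI impI)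
      fix m n assume "M \<le> m" "M \<le> n"
      then show "dist (X (k m) t) (X (k n) t) < e"
        using M[of m n] near[of "k m"] near[of "k n"] by metric
    qed
  qed
  then obtain x where x: "\<And>t. 0 \<le> t \<Longrightarrow> (\<lambda>n. X (k n) t) \<longlonglongrightarrow> x t"
    unfolding convergent_def by metis
  have xlip: "norm (x t - x s) \<le> B * \<bar>t - s\<bar>" if "0 \<le> s" "0 \<le> t" for s t
    by (rule LIMSEQ_le_const2[OF tendsto_norm[OF tendsto_diff[OF x[OF that(2)] x[OF that(1)]]]])
      (use lip in auto)
  have xcont: "continuous_on {0..} x"
    by (rule lipschitz_on_continuous_on[of B], rule lipschitz_onI) (use xlip B in \<open>auto simp: dist_norm\<close>)
  have ucont: "continuous_on {0..} (\<lambda>s. u (x s))"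
    by (rule continuous_on_compose2[OF cont xcont]) auto
  have hk0: "(\<lambda>n. h (k n)) \<longlonglongrightarrow> 0"
  proof -
    have "h \<longlonglongrightarrow> 0"
      unfolding h_def using LIMSEQ_inverse_real_of_nat by (simp add: inverse_eq_divide add.commute)
    then show ?thesis using k LIMSEQ_subseq_LIMSEQ by (auto simp: o_def)
  qed
  have delayed: "(\<lambda>n. X (k n) (s - h (k n))) \<longlonglongrightarrow> x s" if "0 \<le> s" for s
  proof -
    have "(\<lambda>n. X (k n) (s - h (k n)) - X (k n) s) \<longlonglongrightarrow> 0"
    proof (rule Lim_null_comparison)
      show "\<forall>\<^sub>F n in sequentially. norm (X (k n) (s - h (k n)) - X (k n) s) \<le> B * h (k n)"
        using lip[of _ "s - h _" s] h by (intro always_eventually allI) (simp add: less_imp_le)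
      show "(\<lambda>n. B * h (k n)) \<longlonglongrightarrow> 0" using tendsto_mult_right_zero[OF hk0] .
    qed
    from tendsto_add[OF this x[OF that]] show ?thesis by simp
  qed
  have xint: "x t = q0 + integral {0..t} (\<lambda>s. u (x s))" if t: "0 \<le> t" for t
  proof -
    have "(\<lambda>n. integral {0..t} (\<lambda>s. u (X (k n) (s - h (k n))))) \<longlonglongrightarrow> integral {0..t} (\<lambda>s. u (x s))"
    proof (rule dominated_convergence(2)[where h="\<lambda>_. B"])
      fix n
      show "(\<lambda>s. u (X (k n) (s - h (k n)))) integrable_on {0..t}"
      proof (rule integrable_continuous_real, rule continuous_on_compose2[OF cont])
        show "continuous_on {0..t} (\<lambda>s. X (k n) (s - h (k n)))"
          by (rule continuous_on_compose2[OF Xcont[of UNIV]]) (auto intro!: continuous_intros)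
      qed auto
    next
      fix s assume "s \<in> {0..t}"
      then show "(\<lambda>n. u (X (k n) (s - h (k n)))) \<longlonglongrightarrow> u (x s)"
        using cont delayed[of s] by (auto intro: continuous_on_tendsto_compose)
    qed (use bnd in auto)
    from tendsto_add[OF tendsto_const this]
    have "(\<lambda>n. q0 + integral {0..t} (\<lambda>s. u (X (k n) (s - h (k n))))) \<longlonglongrightarrow> q0 + integral {0..t} (\<lambda>s. u (x s))" .
    moreover have "\<forall>\<^sub>F n in sequentially. q0 + integral {0..t} (\<lambda>s. u (X (k n) (s - h (k n)))) = X (k n) t"
    proof -
      obtain M :: nat where M: "t \<le> real M" using real_arch_simple by blast
      show ?thesis
      proof (rule eventually_sequentiallyI[of M])
        fix n assume "M \<le> n"
        then have "t \<le> real (k n) + 1" using M seq_suble[OF k, of n] by linarith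
        from Xeq[OF this] show "q0 + integral {0..t} (\<lambda>s. u (X (k n) (s - h (k n)))) = X (k n) t" by simp
      qed
    qed
    ultimately have "(\<lambda>n. X (k n) t) \<longlonglongrightarrow> q0 + integral {0..t} (\<lambda>s. u (x s))"
      by (rule Lim_transform_eventually)
    then show ?thesis using x[OF t] LIMSEQ_unique by blast
  qed
  have der: "(x has_vector_derivative u (x t)) (at t)" if t: "t > 0" for t
  proof -
    have "((\<lambda>r. q0 + integral {0..r} (\<lambda>s. u (x s))) has_vector_derivative 0 + u (x t)) (at t within {0..t+1})"
      by (intro has_vector_derivative_add has_vector_derivative_const integral_has_vector_derivative)
        (use t continuous_on_subset[OF ucont] in auto)
    then have "(x has_vector_derivative u (x t)) (at t within {0..t+1})"
      using has_vector_derivative_transform[of t "{0..t+1}" x "\<lambda>r. q0 + integral {0..r} (\<lambda>s. u (x s))"] t xint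
      by auto
    then show ?thesis using t at_within_interior[of t "{0..t+1}"] by simp
  qed
  have "x \<in> cara_solutions u q0"
    unfolding cara_solutions_def
  proof (intro CollectI conjI allI impI)
    show "x 0 = q0" using xint[of 0] by simp
    show "abs_continuous_on 0 T x" for T
      by (rule lipschitz_imp_abs_continuous_on[of _ _ _ B])
        (metis xlip abs_of_nonneg diff_ge_0_iff_ge order_trans)
    \<comment> \<open>At 0 the two-sided derivative would depend on the arbitrary values of
      \<open>x\<close> at negative times; the single point is null.\<close>
    have "AE t in lebesgue. t \<notin> {0::real}"
      by (rule AE_not_in) (simp flip: negligible_iff_null_sets)
    then show "AE t in lebesgue. 0 \<le> t \<longrightarrow> (x has_vector_derivative u (x t)) (at t)"
      by eventually_elim (use der in auto)
  qed
  then show ?thesis by blast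
qed

section \<open>Lyapunov functions controlling the speed\<close>

lemma cara_solutions_continuous_on:
  assumes "x \<in> cara_solutions v q0"
  shows "continuous_on {0..T} x"
proof (cases "T \<ge> 0")
  case True
  then show ?thesis using assms by (auto simp: cara_solutions_def intro: abs_continuous_on_imp_continuous_on)
qed auto

text \<open>By the fundamental theorem the almost everywhere derivative integrates back to
  \<open>x\<close>. If it is continuous along the trajectory, \<open>x\<close> is a primitive of a
  continuous function and the exceptional set disappears.\<close>

lemma cara_solution_has_vector_derivative:
  fixes v :: "'a::euclidean_space \<Rightarrow> 'a"
  assumes x: "x \<in> cara_solutions v q0" and T: "0 \<le> T" and t: "t \<in> {0..T}"
    and cont: "continuous_on {0..T} (\<lambda>s. v (x s))"
  shows "(x has_vector_derivative v (x t)) (at t within {0..T})"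
proof -
  define N where "N = {t. \<not> (0 \<le> t \<longrightarrow> (x has_vector_derivative v (x t)) (at t))}"
  have ac: "\<And>T. 0 \<le> T \<Longrightarrow> abs_continuous_on 0 T x" and x0: "x 0 = q0"
    and ae: "AE t in lebesgue. 0 \<le> t \<longrightarrow> (x has_vector_derivative v (x t)) (at t)"
    using x by (auto simp: cara_solutions_def)
  from ae have "N \<in> null_sets lebesgue"
    unfolding N_def by (subst (asm) completion.AE_iff_null_sets) auto
  then have N: "negligible N" by (simp add: negligible_iff_null_sets)
  have "integral {0..s} (\<lambda>s. v (x s)) = x s - x 0" if "s \<in> {0..T}" for s
  proof (rule integral_unique, rule abs_continuous_on_has_integral_deriv[OF ac _ N])
    fix r assume "r \<in> {0..s} - N"
    then show "(x has_vector_derivative v (x r)) (at r within {0..s})"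
      by (auto simp: N_def intro: has_vector_derivative_at_within)
  qed (use that in auto)
  then have eq: "x s = x 0 + integral {0..s} (\<lambda>s. v (x s))" if "s \<in> {0..T}" for s
    using that by simp
  have "((\<lambda>r. x 0 + integral {0..r} (\<lambda>s. v (x s))) has_vector_derivative 0 + v (x t)) (at t within {0..T})"
    by (intro has_vector_derivative_add has_vector_derivative_const integral_has_vector_derivative cont t)
  then have "((\<lambda>r. x 0 + integral {0..r} (\<lambda>s. v (x s))) has_vector_derivative v (x t)) (at t within {0..T})"
    by (simp only: add_0)
  then show ?thesis
    by (rule has_vector_derivative_transform[rotated 2]) (rule t, erule eq)
qed

text \<open>The factor 2 in \<open>decay\<close> makes \<open>sqrt V\<close> decay at rate
  \<open>c\<close>, and \<open>u_bound\<close> compares the speed with exactly this quantity.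
  Continuity of \<open>u\<close> is required relative to \<open>S\<close> only, so that
  \<open>S\<close> may be shrunk to a closed ball.\<close>

locale lyapunov_ball =
  fixes u :: "'a::euclidean_space \<Rightarrow> 'a" and V :: "'a \<Rightarrow> real" and V' :: "'a \<Rightarrow> 'a \<Rightarrow> real"
    and S :: "'a set" and c K :: real
  assumes c: "c > 0" and K: "K \<ge> 0"
    and u_cont: "continuous_on S u"
    and V_deriv: "\<And>z. z \<in> S \<Longrightarrow> (V has_derivative V' z) (at z)"
    and V_nonneg: "\<And>z. z \<in> S \<Longrightarrow> 0 \<le> V z"
    and decay: "\<And>z. z \<in> S \<Longrightarrow> V' z (u z) \<le> - (2 * c) * V z"
    and u_bound: "\<And>z. z \<in> S \<Longrightarrow> norm (u z) \<le> K * sqrt (V z)"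
begin

context
  fixes v :: "'a \<Rightarrow> 'a" and x :: "real \<Rightarrow> 'a" and q0 :: 'a
  assumes x: "x \<in> cara_solutions v q0" and agree: "\<And>z. z \<in> S \<Longrightarrow> v z = u z"
begin

text \<open>The trajectory solves a field \<open>v\<close> that agrees with \<open>u\<close> only on
  \<open>S\<close>. The estimates thus serve both for solutions of \<open>u\<close> and for those of
  the modified field from which existence is derived.\<close>

lemma trajectory_deriv:
  assumes T: "0 \<le> T" and stay: "\<And>t. 0 \<le> t \<Longrightarrow> t \<le> T \<Longrightarrow> x t \<in> S" and t: "t \<in> {0..T}"
  shows "(x has_vector_derivative u (x t)) (at t within {0..T})"
proof -
  have "continuous_on {0..T} (\<lambda>s. u (x s))"
    by (rule continuous_on_compose2[OF u_cont cara_solutions_continuous_on[OF x]]) (use stay in auto)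
  moreover have "continuous_on {0..T} (\<lambda>s. u (x s)) \<longleftrightarrow> continuous_on {0..T} (\<lambda>s. v (x s))"
    by (rule continuous_on_cong) (use stay agree in auto)
  ultimately have "continuous_on {0..T} (\<lambda>s. v (x s))" by simp
  from cara_solution_has_vector_derivative[OF x T t this] show ?thesis
    using agree stay t by auto
qed

lemma V_decay:
  assumes T: "0 \<le> T" and stay: "\<And>t. 0 \<le> t \<Longrightarrow> t \<le> T \<Longrightarrow> x t \<in> S"
  shows "V (x T) \<le> V q0 * exp (- (2 * c * T))"
proof -
  \<comment> \<open>Integrating factor: \<open>decay\<close> says precisely that this product does
    not increase.\<close>
  let ?g = "\<lambda>t. V (x t) * exp (2 * c * t)"
  have der: "(?g has_real_derivative
      (V' (x t) (u (x t)) + 2 * c * V (x t)) * exp (2 * c * t)) (at t within {0..T})"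
    if t: "t \<in> {0..T}" for t
  proof -
    have "x t \<in> S" using stay t by auto
    have "((V \<circ> x) has_vector_derivative V' (x t) (u (x t))) (at t within {0..T})"
      by (rule vector_derivative_diff_chain_within)
        (use trajectory_deriv[OF T stay t] V_deriv[OF \<open>x t \<in> S\<close>] in \<open>auto intro: has_derivative_at_withinI\<close>)
    then have Vx: "((\<lambda>t. V (x t)) has_real_derivative V' (x t) (u (x t))) (at t within {0..T})"
      by (simp add: has_real_derivative_iff_has_vector_derivative o_def)
    show ?thesis
      by (rule derivative_eq_intros Vx | simp add: algebra_simps)+
  qed
  have "?g T \<le> ?g 0"
  proof (rule DERIV_nonpos_imp_decreasing_open[OF T])
    fix t assume t: "0 < t" "t < T"
    have S: "x t \<in> S" using stay t by auto
    have "(?g has_real_derivative (V' (x t) (u (x t)) + 2 * c * V (x t)) * exp (2 * c * t)) (at t)"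
      using der[of t] t at_within_interior[of t "{0..T}"] by simp
    moreover have "(V' (x t) (u (x t)) + 2 * c * V (x t)) * exp (2 * c * t) \<le> 0"
      using decay[OF S] by (intro mult_nonpos_nonneg) auto
    ultimately show "\<exists>y. (?g has_real_derivative y) (at t) \<and> y \<le> 0" by blast
  next
    show "continuous_on {0..T} ?g"
      using der by (meson DERIV_continuous continuous_on_eq_continuous_within)
  qed
  moreover have "x 0 = q0" using x by (simp add: cara_solutions_def)
  ultimately have "V (x T) * exp (2 * c * T) \<le> V q0" by simp
  then have "V (x T) * exp (2 * c * T) * exp (- (2 * c * T)) \<le> V q0 * exp (- (2 * c * T))"
    by (simp add: mult_right_mono)
  then show ?thesis by (simp add: mult.assoc flip: exp_add)
qed

text \<open>By \<open>V_decay\<close> and \<open>u_bound\<close> the speed at time \<open>r\<close>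
  is at most \<open>K * sqrt (V q0) * exp (- (c * r))\<close>; the bound is the integral of this
  function, with primitive \<open>\<phi>\<close>.\<close>

lemma path_length:
  assumes st: "0 \<le> s" "s \<le> t" and stay: "\<And>r. 0 \<le> r \<Longrightarrow> r \<le> t \<Longrightarrow> x r \<in> S"
  shows "norm (x t - x s) \<le> K / c * sqrt (V q0) * (exp (- (c * s)) - exp (- (c * t)))"
proof (cases "s = t")
  case False
  let ?M = "K * sqrt (V q0)"
  define \<phi> where "\<phi> r = - (K / c * sqrt (V q0) * exp (- (c * r)))" for r
  have "norm (x t - x s) \<le> \<phi> t - \<phi> s"
  proof (rule differentiable_bound_general[where f'="\<lambda>r. u (x r)" and \<phi>'="\<lambda>r. ?M * exp (- (c * r))"])
    show "s < t" using st False by simp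
    show "continuous_on {s..t} x"
      using continuous_on_subset[OF cara_solutions_continuous_on[OF x, of t]] st by auto
    show "continuous_on {s..t} \<phi>" unfolding \<phi>_def by (intro continuous_intros)
    fix r assume r: "s < r" "r < t"
    have T: "0 \<le> t" using st by simp
    show "(x has_vector_derivative u (x r)) (at r)"
      using trajectory_deriv[OF T stay, of r] r st at_within_interior[of r "{0..t}"] by simp
    have "(\<phi> has_real_derivative ?M * exp (- (c * r))) (at r)"
      unfolding \<phi>_def by (rule derivative_eq_intros refl | use c in \<open>simp add: field_simps\<close>)+
    then show "(\<phi> has_vector_derivative ?M * exp (- (c * r))) (at r)"
      by (simp add: has_real_derivative_iff_has_vector_derivative)
    have rS: "x r \<in> S" using stay r st by auto
    have "V (x r) \<le> V q0 * exp (- (2 * c * r))"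
      by (rule V_decay) (use stay r st in auto)
    also have "\<dots> = V q0 * (exp (- (c * r)))\<^sup>2"
      by (simp add: power2_eq_square flip: exp_add)
    finally have "sqrt (V (x r)) \<le> sqrt (V q0) * exp (- (c * r))"
      by (metis real_sqrt_le_mono real_sqrt_mult real_sqrt_abs abs_exp_cancel)
    then have "K * sqrt (V (x r)) \<le> K * (sqrt (V q0) * exp (- (c * r)))"
      using K by (rule mult_left_mono)
    then show "norm (u (x r)) \<le> ?M * exp (- (c * r))"
      using u_bound[OF rS] by (simp add: mult.assoc)
  qed
  then show ?thesis by (simp add: \<phi>_def algebra_simps)
qed auto

lemma path_length_le:
  assumes st: "0 \<le> s" "s \<le> t" and stay: "\<And>r. 0 \<le> r \<Longrightarrow> r \<le> t \<Longrightarrow> x r \<in> S"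
  shows "norm (x t - x s) \<le> K / c * sqrt (V q0) * exp (- (c * s))"
proof -
  have "x 0 = q0" using x by (simp add: cara_solutions_def)
  then have "V q0 \<ge> 0" using V_nonneg stay[of 0] st by auto
  then have "K / c * sqrt (V q0) * (exp (- (c * s)) - exp (- (c * t))) \<le> K / c * sqrt (V q0) * exp (- (c * s))"
    using K c by (intro mult_left_mono) auto
  then show ?thesis using path_length[OF st stay] by simp
qed

text \<open>First exit argument: until the trajectory first meets the sphere of radius
  \<open>e\<close> it lies in \<open>S\<close>, so the length bound applies and keeps it strictly
  inside.\<close>

lemma trajectory_trapped:
  assumes sub: "cball q e \<subseteq> S" and small: "norm (q0 - q) + K / c * sqrt (V q0) < e"
    and nonneg: "0 \<le> V q0" and t: "0 \<le> t"
  shows "norm (x t - q) < e"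
proof (rule ccontr)
  assume neg: "\<not> norm (x t - q) < e"
  have x0: "x 0 = q0" using x by (simp add: cara_solutions_def)
  let ?g = "\<lambda>t. norm (x t - q)"
  have cont: "continuous_on {0..T} ?g" for T
    by (intro continuous_intros cara_solutions_continuous_on[OF x])
  have Kc: "0 \<le> K / c * sqrt (V q0)" using K c nonneg by simp
  then have g0: "?g 0 < e" using small x0 by simp
  \<comment> \<open>The times spent on the sphere form a compact set, so there is a first
    one.\<close>
  define A where "A = {0..t} \<inter> ?g -` {e}"
  have "A \<noteq> {}" using IVT'[of ?g 0 e t] g0 neg cont[of t] t by (force simp: A_def)
  moreover have "compact A"
    unfolding A_def compact_eq_bounded_closed
    by (auto intro: bounded_subset[of "{0..t}"] continuous_closed_preimage[OF cont])
  ultimately obtain T where T: "T \<in> A" "\<And>s. s \<in> A \<Longrightarrow> T \<le> s"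
    using compact_attains_inf[of A] by blast
  have T0: "0 \<le> T" "T \<le> t" "?g T = e" using T(1) by (auto simp: A_def)
  have "?g s \<le> e" if s: "0 \<le> s" "s \<le> T" for s
  proof (rule ccontr)
    assume "\<not> ?g s \<le> e"
    then obtain r where "0 \<le> r" "r \<le> s" "?g r = e" using IVT'[of ?g 0 e s] g0 cont[of s] s by force
    then have "r = T" using T(2)[of r] s T0 by (force simp: A_def)
    then show False using \<open>r \<le> s\<close> s \<open>\<not> ?g s \<le> e\<close> T0 by auto
  qed
  then have stay: "x s \<in> S" if "0 \<le> s" "s \<le> T" for s
    using that sub by (auto simp: dist_norm norm_minus_commute subset_iff)
  have "norm (x T - x 0) \<le> K / c * sqrt (V q0) * exp (- (c * 0))"
    by (rule path_length_le) (use T0 stay in auto)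
  moreover have "?g T \<le> norm (x T - x 0) + norm (x 0 - q)"
    using norm_triangle_ineq[of "x T - x 0" "x 0 - q"] by simp
  ultimately show False using small T0(3) x0 by simp
qed

text \<open>The remaining length after time \<open>s\<close> is of order
  \<open>exp (- (c * s))\<close>, so the trajectory is Cauchy and has a limit. Closedness of
  \<open>F\<close> keeps that limit inside \<open>S\<close>, where \<open>V\<close> is continuous
  and the decay forces the value 0.\<close>

lemma trajectory_converges:
  assumes stay: "\<And>t. 0 \<le> t \<Longrightarrow> x t \<in> F" and F: "closed F" "F \<subseteq> S"
  shows "\<exists>l\<in>F. (x \<longlongrightarrow> l) at_top \<and> V l = 0"
proof -
  have x0: "x 0 = q0" using x by (simp add: cara_solutions_def)
  have q0: "0 \<le> V q0" using V_nonneg stay[of 0] F x0 by auto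
  have stayS: "x t \<in> S" if "0 \<le> t" for t using stay that F by blast
  have lim0: "((\<lambda>t. a * exp (- (d * t))) \<longlongrightarrow> 0) at_top" if "d > 0" for a d :: real
  proof -
    have "filterlim (\<lambda>t. - (d * t)) at_bot at_top"
      using that by (simp add: filterlim_uminus_at_bot filterlim_tendsto_pos_mult_at_top[OF tendsto_const _ filterlim_ident])
    then have "((\<lambda>t. exp (- (d * t))) \<longlongrightarrow> 0) at_top"
      by (rule filterlim_compose[OF exp_at_bot])
    then show ?thesis by (rule tendsto_mult_right_zero)
  qed
  have "cauchy_filter (filtermap x at_top)"
    unfolding cauchy_filter_metric_filtermap
  proof (intro allI impI)
    fix e :: real assume e: "e > 0"
    have "\<forall>\<^sub>F t in at_top. K / c * sqrt (V q0) * exp (- (c * t)) < e / 2"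
      by (rule order_tendstoD(2)[OF lim0[OF c]]) (use e in simp)
    then obtain T where T: "\<And>t. t \<ge> T \<Longrightarrow> K / c * sqrt (V q0) * exp (- (c * t)) < e / 2"
      by (auto simp: eventually_at_top_linorder)
    define T' where "T' = max T 0"
    have near: "dist (x t) (x T') < e / 2" if "t \<ge> T'" for t
    proof -
      have "norm (x t - x T') \<le> K / c * sqrt (V q0) * exp (- (c * T'))"
        by (rule path_length_le) (use that stayS in \<open>auto simp: T'_def\<close>)
      also have "\<dots> < e / 2" by (rule T) (simp add: T'_def)
      finally show ?thesis by (simp add: dist_norm)
    qed
    show "\<exists>P. eventually P at_top \<and> (\<forall>s t. P s \<and> P t \<longrightarrow> dist (x s) (x t) < e)"
    proof (intro exI[of _ "\<lambda>t. t \<ge> T'"] conjI allI impI)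
      show "eventually (\<lambda>t. t \<ge> T') at_top" by (rule eventually_ge_at_top)
      fix s t assume "T' \<le> s \<and> T' \<le> t"
      then show "dist (x s) (x t) < e" using near[of s] near[of t] by metric
    qed
  qed
  then obtain l where l: "(x \<longlongrightarrow> l) at_top"
    using cauchy_filter_complete_converges[OF _ complete_UNIV, of "filtermap x at_top"]
    by (auto simp: filterlim_def filtermap_bot_iff)
  have lF: "l \<in> F"
  proof (rule Lim_in_closed_set[OF F(1) _ _ l])
    show "\<forall>\<^sub>F t in at_top. x t \<in> F"
      using eventually_ge_at_top[of 0] by eventually_elim (rule stay)
  qed simp
  then have lS: "l \<in> S" using F by blast
  have "isCont V l" using V_deriv[OF lS] has_derivative_continuous by blast
  then have Vl: "((\<lambda>t. V (x t)) \<longlongrightarrow> V l) at_top" using l by (rule isCont_tendsto_compose)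
  have "V l \<le> 0"
  proof (rule tendsto_le[OF _ lim0[of "2*c" "V q0"] Vl])
    show "\<forall>\<^sub>F t in at_top. V (x t) \<le> V q0 * exp (- (2 * c * t))"
      using eventually_ge_at_top[of 0]
      by eventually_elim (rule V_decay, use stayS in auto)
  qed (use c in auto)
  then show ?thesis using l lF V_nonneg[OF lS] by force
qed

end

text \<open>Outside \<open>S\<close> nothing is known about \<open>u\<close>, so existence is first
  obtained for \<open>u\<close> composed with the projection onto a closed ball, a bounded
  continuous field. The length bound traps its solutions in the ball, where both fields agree.
  Limits are located in \<open>interior S\<close> so that the lemma can be applied to them
  again.\<close>

lemma local_behaviour:
  assumes q: "q \<in> interior S" and Vq: "V q = 0" and e: "e > 0"
  shows "\<exists>d>0. \<forall>q0. norm (q0 - q) \<le> d \<longrightarrow> cara_solutions u q0 \<noteq> {} \<and>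
     (\<forall>x\<in>cara_solutions u q0. (\<forall>t\<ge>0. norm (x t - q) < e) \<and>
        (\<exists>l\<in>interior S. (x \<longlongrightarrow> l) at_top \<and> V l = 0))"
proof -
  obtain r0 where r0: "r0 > 0" "cball q r0 \<subseteq> interior S"
    using q open_interior open_contains_cball by blast
  define r where "r = min r0 e"
  have r: "r > 0" "r \<le> e" "cball q r \<subseteq> interior S" "cball q r \<subseteq> S"
    using r0 e interior_subset[of S] by (auto simp: r_def)
  have "isCont V q"
    using V_deriv q interior_subset has_derivative_continuous by blast
  then have lim: "((\<lambda>z. norm (z - q) + K / c * sqrt (V z)) \<longlongrightarrow> norm (q - q) + K / c * sqrt (V q)) (at q)"
    by (intro tendsto_intros) (auto simp: isCont_def)
  have "\<forall>\<^sub>F z in at q. norm (z - q) + K / c * sqrt (V z) < r"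
    using order_tendstoD(2)[OF lim] r Vq by simp
  then obtain d0 where d0: "d0 > 0" "\<And>z. z \<noteq> q \<Longrightarrow> dist z q < d0 \<Longrightarrow> norm (z - q) + K / c * sqrt (V z) < r"
    by (auto simp: eventually_at)
  \<comment> \<open>Stability quantifies over a closed ball of initial values whereas the limit
    provides an open one, hence \<open>d0 / 2\<close>.\<close>
  define d where "d = min (d0 / 2) r"
  have d: "d > 0" using d0 r by (simp add: d_def)
  have small: "norm (z - q) + K / c * sqrt (V z) < r \<and> z \<in> cball q r" if "norm (z - q) \<le> d" for z
  proof (cases "z = q")
    case True
    then show ?thesis using r Vq by simp
  next
    case False
    then have "dist z q < d0" using that d0 by (auto simp: d_def dist_norm)
    then show ?thesis using d0(2)[OF False] that by (auto simp: d_def dist_norm norm_minus_commute)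
  qed
  have behave: "(\<forall>t\<ge>0. norm (x t - q) < r) \<and> (\<exists>l\<in>cball q r. (x \<longlongrightarrow> l) at_top \<and> V l = 0)"
    if x: "x \<in> cara_solutions v q0" and agree: "\<And>z. z \<in> cball q r \<Longrightarrow> v z = u z"
      and q0: "norm (q0 - q) \<le> d" for x v q0
  proof -
    interpret B: lyapunov_ball u V V' "cball q r" c K
      by unfold_locales (use c K u_cont V_deriv V_nonneg decay u_bound r(4) in \<open>auto intro: continuous_on_subset\<close>)
    have "0 \<le> V q0" using small[OF q0] V_nonneg r(4) by blast
    then have trap: "norm (x t - q) < r" if "0 \<le> t" for t
      using B.trajectory_trapped[OF x agree _ _ _ that, of q r] small[OF q0] by auto
    moreover have "\<exists>l\<in>cball q r. (x \<longlongrightarrow> l) at_top \<and> V l = 0"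
    proof (rule B.trajectory_converges[OF x agree])
      show "x t \<in> cball q r" if "0 \<le> t" for t
        using trap[OF that] by (simp add: dist_norm norm_minus_commute)
    qed auto
    ultimately show ?thesis by blast
  qed
  have exist: "cara_solutions u q0 \<noteq> {}" if q0: "norm (q0 - q) \<le> d" for q0
  proof -
    define v where "v z = u (closest_point (cball q r) z)" for z
    have agree: "v z = u z" if "z \<in> cball q r" for z
      using that by (simp add: v_def closest_point_self)
    have in_ball: "closest_point (cball q r) z \<in> cball q r" for z
      using r by (intro closest_point_in_set) auto
    have ucont: "continuous_on (cball q r) u" using u_cont r(4) continuous_on_subset by blast
    have vcont: "continuous_on UNIV v"
      unfolding v_def
      by (rule continuous_on_compose2[OF ucont continuous_on_closest_point]) (use r in_ball in auto)
    have "bounded (u ` cball q r)"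
      by (intro compact_imp_bounded compact_continuous_image[OF ucont]) simp
    then obtain M where M: "\<And>z. z \<in> cball q r \<Longrightarrow> norm (u z) \<le> M"
      unfolding bounded_iff by (metis imageI)
    have "cara_solutions v q0 \<noteq> {}"
      by (rule peano_existence[OF vcont, of M]) (use M in_ball in \<open>simp add: v_def\<close>)
    then obtain x where x: "x \<in> cara_solutions v q0" by blast
    then have "\<forall>t\<ge>0. norm (x t - q) < r" using behave agree q0 by blast
    then have "v (x t) = u (x t)" if "0 \<le> t" for t
      using that by (intro agree) (simp add: dist_norm norm_minus_commute less_imp_le)
    then have "x \<in> cara_solutions u q0" using x by (auto simp: cara_solutions_def elim!: eventually_mono)
    then show ?thesis by blast
  qed
  show ?thesis
  proof (intro exI[of _ d] conjI allI impI ballI)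
    fix q0 assume q0: "norm (q0 - q) \<le> d"
    then show "cara_solutions u q0 \<noteq> {}" by (rule exist)
    fix x assume x: "x \<in> cara_solutions u q0"
    note b = behave[OF x refl q0]
    show "norm (x t - q) < e" if "0 \<le> t" for t
      using conjunct1[OF b] that r(2) by force
    show "\<exists>l\<in>interior S. (x \<longlongrightarrow> l) at_top \<and> V l = 0"
      using conjunct2[OF b] r(3) by blast
  qed (rule d)
qed

text \<open>Nothing singles out the target: by \<open>u_bound\<close> every zero of \<open>V\<close>
  is an equilibrium, and \<open>local_behaviour\<close> applies to each one in the interior. This
  supplies the stability of the limits that semistability demands.\<close>

lemma zero_stable:
  assumes "q \<in> interior S" "V q = 0"
  shows "stable_eq u q"
  unfolding stable_eq_def
proof (intro conjI allI impI)
  show "equilibrium u q"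
    using u_bound[of q] assms interior_subset by (force simp: equilibrium_def)
  fix e :: real assume "e > 0"
  from local_behaviour[OF assms this]
  show "\<exists>d>0. \<forall>q0. norm (q0 - q) \<le> d \<longrightarrow> cara_solutions u q0 \<noteq> {} \<and>
      (\<forall>x\<in>cara_solutions u q0. \<forall>t\<ge>0. norm (x t - q) < e)"
    by (elim exE conjE) (intro exI conjI, assumption, simp)
qed

theorem zero_semistable:
  assumes "q \<in> interior S" "V q = 0"
  shows "semistable_eq u q"
  unfolding semistable_eq_def
proof (rule conjI[OF zero_stable[OF assms]])
  obtain d where d: "d > 0" "\<forall>q0. norm (q0 - q) \<le> d \<longrightarrow> cara_solutions u q0 \<noteq> {} \<and>
     (\<forall>x\<in>cara_solutions u q0. (\<forall>t\<ge>0. norm (x t - q) < 1) \<and>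
        (\<exists>l\<in>interior S. (x \<longlongrightarrow> l) at_top \<and> V l = 0))"
    using local_behaviour[OF assms zero_less_one] by (elim exE conjE)
  show "\<exists>d>0. \<forall>q0. norm (q0 - q) \<le> d \<longrightarrow> cara_solutions u q0 \<noteq> {} \<and>
      (\<forall>x\<in>cara_solutions u q0. \<exists>qs. stable_eq u qs \<and> (x \<longlongrightarrow> qs) at_top)"
  proof (intro exI[of _ d] conjI allI impI ballI d(1))
    fix q0 assume q0: "norm (q0 - q) \<le> d"
    then show "cara_solutions u q0 \<noteq> {}" using d(2) by blast
    fix x assume "x \<in> cara_solutions u q0"
    then obtain l where "l \<in> interior S" "(x \<longlongrightarrow> l) at_top" "V l = 0" using d(2) q0 by blast
    then show "\<exists>qs. stable_eq u qs \<and> (x \<longlongrightarrow> qs) at_top" using zero_stable by blast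
  qed
qed

theorem isolated_zero_asymp_stable:
  assumes "q \<in> interior S" "V q = 0" and iso: "\<And>z. z \<in> interior S \<Longrightarrow> V z = 0 \<Longrightarrow> z = q"
  shows "asymp_stable_eq u q"
  unfolding asymp_stable_eq_def
proof (rule conjI[OF zero_stable[OF assms(1,2)]])
  obtain d where d: "d > 0" "\<forall>q0. norm (q0 - q) \<le> d \<longrightarrow> cara_solutions u q0 \<noteq> {} \<and>
     (\<forall>x\<in>cara_solutions u q0. (\<forall>t\<ge>0. norm (x t - q) < 1) \<and>
        (\<exists>l\<in>interior S. (x \<longlongrightarrow> l) at_top \<and> V l = 0))"
    using local_behaviour[OF assms(1,2) zero_less_one] by (elim exE conjE)
  show "\<exists>d>0. \<forall>q0. norm (q0 - q) \<le> d \<longrightarrow> (\<forall>x\<in>cara_solutions u q0. (x \<longlongrightarrow> q) at_top)"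
  proof (intro exI[of _ d] conjI allI impI ballI d(1))
    fix q0 x assume "norm (q0 - q) \<le> d" "x \<in> cara_solutions u q0"
    then obtain l where "l \<in> interior S" "(x \<longlongrightarrow> l) at_top" "V l = 0" using d(2) by blast
    then show "(x \<longlongrightarrow> q) at_top" using iso by blast
  qed
qed

end

section \<open>Linear systems and coercive forms\<close>

text \<open>Gaussian elimination: an equation with a nonzero coefficient at \<open>j0\<close> is
  solved for that unknown and substituted into the others, which costs one equation and one
  unknown.\<close>

lemma underdetermined_system:
  fixes A :: "'i \<Rightarrow> 'j \<Rightarrow> 'a::field"
  assumes "finite I" "finite J" "card I < card J"
  shows "\<exists>g. (\<exists>j\<in>J. g j \<noteq> 0) \<and> (\<forall>i\<in>I. (\<Sum>j\<in>J. A i j * g j) = 0)"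
  using assms
proof (induction I arbitrary: J A rule: finite_induct)
  case empty
  then have "J \<noteq> {}" by auto
  then show ?case by (intro exI[of _ "\<lambda>_. 1"]) auto
next
  case (insert i I)
  show ?case
  proof (cases "\<forall>j\<in>J. A i j = 0")
    case True
    have "card I < card J" using insert by simp
    then obtain g where "\<exists>j\<in>J. g j \<noteq> 0" "\<forall>i\<in>I. (\<Sum>j\<in>J. A i j * g j) = 0"
      using insert.IH[of J A] insert.prems by blast
    then show ?thesis using True by (intro exI[of _ g]) auto
  next
    case False
    then obtain j0 where j0: "j0 \<in> J" "A i j0 \<noteq> 0" by blast
    let ?J = "J - {j0}"
    have "card I < card ?J" using insert j0 by simp
    then obtain g where g: "\<exists>j\<in>?J. g j \<noteq> 0"
      "\<forall>i'\<in>I. (\<Sum>j\<in>?J. (A i' j - A i' j0 / A i j0 * A i j) * g j) = 0"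
      using insert.IH[of ?J "\<lambda>i' j. A i' j - A i' j0 / A i j0 * A i j"] insert.prems by blast
    \<comment> \<open>Back substitution: the eliminated unknown is recovered from equation
      \<open>i\<close>.\<close>
    define g' where "g' j = (if j = j0 then - (\<Sum>j\<in>?J. A i j * g j) / A i j0 else g j)" for j
    have split: "(\<Sum>j\<in>J. A i' j * g' j) = A i' j0 * g' j0 + (\<Sum>j\<in>?J. A i' j * g j)" for i'
      using j0 insert.prems by (subst sum.remove[of J j0]) (auto simp: g'_def intro!: sum.cong)
    have "(\<Sum>j\<in>J. A i' j * g' j) = 0" if "i' \<in> I" for i'
    proof -
      have "(\<Sum>j\<in>?J. A i' j * g j) = A i' j0 / A i j0 * (\<Sum>j\<in>?J. A i j * g j)"
        using g(2) that by (simp add: algebra_simps sum_subtractf sum_distrib_left)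
      then show ?thesis unfolding split by (simp add: g'_def)
    qed
    moreover have "(\<Sum>j\<in>J. A i j * g' j) = 0"
      unfolding split using j0 by (simp add: g'_def)
    moreover have "\<exists>j\<in>J. g' j \<noteq> 0" using g(1) by (auto simp: g'_def)
    ultimately show ?thesis by (intro exI[of _ g']) auto
  qed
qed

text \<open>Matrices are functions on a finite index set, because the size \<open>m\<close> and the
  blocks are terms and not types.\<close>

definition inj_matrix_on :: "'i set \<Rightarrow> ('i \<Rightarrow> 'i \<Rightarrow> real) \<Rightarrow> bool" where
  "inj_matrix_on I A \<longleftrightarrow> (\<forall>x. (\<forall>i\<in>I. (\<Sum>j\<in>I. A i j * x j) = 0) \<longrightarrow> (\<forall>j\<in>I. x j = 0))"

lemma inj_matrix_onD:
  "inj_matrix_on I A \<Longrightarrow> (\<And>i. i \<in> I \<Longrightarrow> (\<Sum>j\<in>I. A i j * x j) = 0) \<Longrightarrow> j \<in> I \<Longrightarrow> x j = 0"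
  unfolding inj_matrix_on_def by blast

text \<open>The vector \<open>- z\<close> is adjoined as an extra column \<open>None\<close>, so
  that there are more unknowns than equations. By injectivity a nontrivial solution must use that
  column, and dividing by its coefficient solves the inhomogeneous system.\<close>

lemma inj_matrix_on_imp_surj:
  fixes A :: "nat \<Rightarrow> nat \<Rightarrow> real"
  assumes fin: "finite I" and inj: "inj_matrix_on I A"
  shows "\<exists>x. \<forall>i\<in>I. (\<Sum>j\<in>I. A i j * x j) = z i"
proof -
  define A' where "A' i j = (case j of None \<Rightarrow> - z i | Some j \<Rightarrow> A i j)" for i j
  have "card I < card (insert None (Some ` I))"
    using fin by (simp add: card_image)
  then obtain g where g: "\<exists>j\<in>insert None (Some ` I). g j \<noteq> 0"
    "\<forall>i\<in>I. (\<Sum>j\<in>insert None (Some ` I). A' i j * g j) = 0"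
    using underdetermined_system[of I "insert None (Some ` I)" A'] fin by auto
  have eq: "(\<Sum>j\<in>I. A i j * g (Some j)) = z i * g None" if "i \<in> I" for i
    using g(2) that fin by (simp add: A'_def sum.reindex)
  have "g None \<noteq> 0"
  proof
    assume 0: "g None = 0"
    then have "\<forall>j\<in>I. g (Some j) = 0"
      using inj eq unfolding inj_matrix_on_def by (metis mult_zero_right)
    with 0 g(1) show False by auto
  qed
  then have "(\<Sum>j\<in>I. A i j * (g (Some j) / g None)) = z i" if "i \<in> I" for i
    using eq[OF that] by (simp flip: sum_divide_distrib)
  then show ?thesis by (intro exI[of _ "\<lambda>j. g (Some j) / g None"]) auto
qed

text \<open>Solving for the unit vectors gives a right inverse \<open>X\<close>; injectivity makes
  it a left inverse as well, and Cauchy-Schwarz applied to \<open>z = X (A z)\<close> yields the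
  estimate.\<close>

lemma inj_matrix_on_bounded_below:
  fixes A :: "nat \<Rightarrow> nat \<Rightarrow> real"
  assumes fin: "finite I" and inj: "inj_matrix_on I A"
  shows "\<exists>c>0. \<forall>z. c * (\<Sum>i\<in>I. (z i)\<^sup>2) \<le> (\<Sum>i\<in>I. (\<Sum>j\<in>I. A i j * z j)\<^sup>2)"
proof -
  have "\<forall>k. \<exists>x. \<forall>i\<in>I. (\<Sum>j\<in>I. A i j * x j) = (if i = k then 1 else 0)"
    by (intro allI inj_matrix_on_imp_surj[OF fin inj])
  then obtain X where X: "\<And>k i. i \<in> I \<Longrightarrow> (\<Sum>j\<in>I. A i j * X k j) = (if i = k then 1 else 0)"
    by metis
  have left: "z j = (\<Sum>k\<in>I. X k j * (\<Sum>h\<in>I. A k h * z h))" if "j \<in> I" for z j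
  proof -
    define y where "y j = z j - (\<Sum>k\<in>I. X k j * (\<Sum>h\<in>I. A k h * z h))" for j
    have "(\<Sum>j\<in>I. A i j * y j) = 0" if i: "i \<in> I" for i
    proof -
      have "(\<Sum>j\<in>I. A i j * (\<Sum>k\<in>I. X k j * (\<Sum>h\<in>I. A k h * z h)))
          = (\<Sum>j\<in>I. \<Sum>k\<in>I. A i j * X k j * (\<Sum>h\<in>I. A k h * z h))"
        by (simp add: sum_distrib_left mult.assoc)
      also have "\<dots> = (\<Sum>k\<in>I. \<Sum>j\<in>I. A i j * X k j * (\<Sum>h\<in>I. A k h * z h))" by (rule sum.swap)
      also have "\<dots> = (\<Sum>k\<in>I. (\<Sum>j\<in>I. A i j * X k j) * (\<Sum>h\<in>I. A k h * z h))"
        by (simp add: sum_distrib_right)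
      also have "\<dots> = (\<Sum>k\<in>I. (if i = k then (\<Sum>h\<in>I. A k h * z h) else 0))"
        using X[OF i] by (intro sum.cong) auto
      also have "\<dots> = (\<Sum>h\<in>I. A i h * z h)" using i fin by simp
      finally show ?thesis by (simp add: y_def algebra_simps sum_subtractf)
    qed
    then have "y j = 0" using inj that unfolding inj_matrix_on_def by blast
    then show ?thesis by (simp add: y_def)
  qed
  define K where "K = 1 + (\<Sum>j\<in>I. \<Sum>k\<in>I. (X k j)\<^sup>2)"
  have K: "K > 0" unfolding K_def by (intro add_pos_nonneg sum_nonneg) auto
  show ?thesis
  proof (intro exI[of _ "1/K"] conjI allI)
    fix z :: "nat \<Rightarrow> real"
    let ?S = "\<Sum>i\<in>I. (\<Sum>j\<in>I. A i j * z j)\<^sup>2"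
    have "(\<Sum>j\<in>I. (z j)\<^sup>2) \<le> (\<Sum>j\<in>I. (\<Sum>k\<in>I. (X k j)\<^sup>2) * ?S)"
      by (intro sum_mono) (subst left, assumption, rule Cauchy_Schwarz_ineq_sum)
    also have "\<dots> = (\<Sum>j\<in>I. \<Sum>k\<in>I. (X k j)\<^sup>2) * ?S" by (simp add: sum_distrib_right)
    also have "\<dots> \<le> K * ?S" unfolding K_def by (intro mult_right_mono sum_nonneg) auto
    finally show "1 / K * (\<Sum>i\<in>I. (z i)\<^sup>2) \<le> ?S" using K by (simp add: field_simps)
  qed (use K in simp)
qed

section \<open>Coercive quadratic forms and their perturbation\<close>

definition qform :: "'i set \<Rightarrow> ('i \<Rightarrow> 'i \<Rightarrow> real) \<Rightarrow> ('i \<Rightarrow> real) \<Rightarrow> real" where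
  "qform I A z = (\<Sum>i\<in>I. \<Sum>j\<in>I. z i * A i j * z j)"

lemma abs_qform_le:
  assumes "finite I"
  shows "\<bar>qform I A z\<bar> \<le> (\<Sum>i\<in>I. \<Sum>j\<in>I. \<bar>A i j\<bar>) * (\<Sum>i\<in>I. (z i)\<^sup>2)"
proof -
  let ?S = "\<Sum>i\<in>I. (z i)\<^sup>2"
  have 1: "\<bar>z i * A i j * z j\<bar> \<le> \<bar>A i j\<bar> * ?S" if "i \<in> I" "j \<in> I" for i j
  proof -
    have sq: "(z i)\<^sup>2 \<le> ?S" "(z j)\<^sup>2 \<le> ?S"
      using assms that by (auto intro!: member_le_sum)
    have "2 * \<bar>z i * z j\<bar> \<le> (z i)\<^sup>2 + (z j)\<^sup>2"
      using sum_squares_bound[of "\<bar>z i\<bar>" "\<bar>z j\<bar>"] by (simp add: abs_mult)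
    then have "\<bar>z i * z j\<bar> \<le> ?S" using sq by simp
    then have "\<bar>A i j\<bar> * \<bar>z i * z j\<bar> \<le> \<bar>A i j\<bar> * ?S" by (simp add: mult_left_mono)
    then show ?thesis by (simp add: abs_mult mult_ac)
  qed
  have "\<bar>qform I A z\<bar> \<le> (\<Sum>i\<in>I. \<Sum>j\<in>I. \<bar>z i * A i j * z j\<bar>)"
    unfolding qform_def by (rule order_trans[OF sum_abs sum_mono[OF sum_abs]])
  also have "\<dots> \<le> (\<Sum>i\<in>I. \<Sum>j\<in>I. \<bar>A i j\<bar> * ?S)" by (intro sum_mono 1)
  finally show ?thesis by (simp add: sum_distrib_right)
qed

text \<open>An entrywise small change alters the form by a small multiple of the squared norm,
  uniformly in \<open>z\<close>, so half of the coercivity survives. It serves twice: for small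
  weights \<eta>, and for points near the target.\<close>

lemma qform_coercive_perturb:
  fixes A :: "'i \<Rightarrow> 'i \<Rightarrow> real"
  assumes fin: "finite I" and c: "c > 0" and coer: "\<And>z. c * (\<Sum>i\<in>I. (z i)\<^sup>2) \<le> qform I A z"
    and lim: "\<And>i j. i \<in> I \<Longrightarrow> j \<in> I \<Longrightarrow> ((\<lambda>t. B t i j) \<longlongrightarrow> A i j) F"
  shows "\<forall>\<^sub>F t in F. \<forall>z. c / 2 * (\<Sum>i\<in>I. (z i)\<^sup>2) \<le> qform I (B t) z"
proof -
  have "((\<lambda>t. \<Sum>i\<in>I. \<Sum>j\<in>I. \<bar>B t i j - A i j\<bar>) \<longlongrightarrow> (\<Sum>i\<in>I. \<Sum>j\<in>I. \<bar>A i j - A i j\<bar>)) F"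
    by (intro tendsto_intros lim)
  then have "\<forall>\<^sub>F t in F. (\<Sum>i\<in>I. \<Sum>j\<in>I. \<bar>B t i j - A i j\<bar>) < c / 2"
    by (rule order_tendstoD) (use c in simp)
  then show ?thesis
  proof eventually_elim
    case (elim t)
    show ?case
    proof
      fix z :: "'i \<Rightarrow> real"
      let ?S = "\<Sum>i\<in>I. (z i)\<^sup>2"
      have "qform I (B t) z = qform I A z + qform I (\<lambda>i j. B t i j - A i j) z"
        by (simp add: qform_def algebra_simps flip: sum.distrib)
      moreover have "\<bar>qform I (\<lambda>i j. B t i j - A i j) z\<bar> \<le> c / 2 * ?S"
        by (rule order_trans[OF abs_qform_le[OF fin]])
          (use elim in \<open>intro mult_right_mono sum_nonneg\<close>, auto)
      ultimately show "c / 2 * ?S \<le> qform I (B t) z" using coer[of z] by linarith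
    qed
  qed
qed

text \<open>For symmetric positive semidefinite \<open>A\<close> one has \<open>|A z|\<^sup>2 \<le> K z\<^sup>T A z\<close>: evaluate the
  form at \<open>z - A z / K\<close>.\<close>
lemma psd_inj_imp_coercive:
  fixes A :: "nat \<Rightarrow> nat \<Rightarrow> real"
  assumes fin: "finite I" and sym: "\<And>i j. i \<in> I \<Longrightarrow> j \<in> I \<Longrightarrow> A i j = A j i"
    and psd: "\<And>z. 0 \<le> qform I A z" and inj: "inj_matrix_on I A"
  shows "\<exists>c>0. \<forall>z. c * (\<Sum>i\<in>I. (z i)\<^sup>2) \<le> qform I A z"
proof -
  obtain c where c: "c > 0" "\<And>z. c * (\<Sum>i\<in>I. (z i)\<^sup>2) \<le> (\<Sum>i\<in>I. (\<Sum>j\<in>I. A i j * z j)\<^sup>2)"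
    using inj_matrix_on_bounded_below[OF fin inj] by blast
  define K where "K = 1 + (\<Sum>i\<in>I. \<Sum>j\<in>I. \<bar>A i j\<bar>)"
  have K: "K > 0" unfolding K_def by (intro add_pos_nonneg sum_nonneg) auto
  have main: "(\<Sum>i\<in>I. (\<Sum>j\<in>I. A i j * z j)\<^sup>2) \<le> K * qform I A z" for z
  proof -
    define y where "y i = (\<Sum>j\<in>I. A i j * z j)" for i
    let ?S = "\<Sum>i\<in>I. (y i)\<^sup>2"
    have S: "?S \<ge> 0" by (intro sum_nonneg) auto
    have cross: "(\<Sum>i\<in>I. \<Sum>j\<in>I. y i * A i j * z j) = ?S"
      by (simp add: y_def power2_eq_square sum_distrib_left mult.assoc)
    have "(\<Sum>i\<in>I. \<Sum>j\<in>I. z i * A i j * y j) = (\<Sum>j\<in>I. \<Sum>i\<in>I. y j * A j i * z i)"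
      by (subst sum.swap) (intro sum.cong refl, simp add: sym mult_ac)
    then have cross': "(\<Sum>i\<in>I. \<Sum>j\<in>I. z i * A i j * y j) = ?S" using cross by simp
    have "qform I A (\<lambda>i. z i - y i / K) = (\<Sum>i\<in>I. \<Sum>j\<in>I. z i * A i j * z j - (y i * A i j * z j) / K
         - (z i * A i j * y j) / K + (y i * A i j * y j) / K\<^sup>2)"
      unfolding qform_def by (intro sum.cong refl) (use K in \<open>simp add: field_simps power2_eq_square\<close>)
    also have "\<dots> = qform I A z - ?S / K - ?S / K + qform I A y / K\<^sup>2"
      by (simp add: qform_def sum.distrib sum_subtractf cross cross' flip: sum_divide_distrib)
    finally have eq: "0 \<le> qform I A z - 2 * (?S / K) + qform I A y / K\<^sup>2"
      using psd[of "\<lambda>i. z i - y i / K"] by simp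
    have "qform I A y \<le> K * ?S"
    proof -
      have "qform I A y \<le> (\<Sum>i\<in>I. \<Sum>j\<in>I. \<bar>A i j\<bar>) * ?S" using abs_qform_le[OF fin, of A y] by simp
      also have "\<dots> \<le> K * ?S" unfolding K_def using S by (intro mult_right_mono) auto
      finally show ?thesis .
    qed
    then have "qform I A y / K\<^sup>2 \<le> ?S / K" using K by (simp add: field_simps power2_eq_square)
    then have "?S / K \<le> qform I A z" using eq by linarith
    then show ?thesis using K by (simp add: y_def field_simps)
  qed
  show ?thesis
  proof (intro exI[of _ "c / K"] conjI allI)
    fix z
    have "c * (\<Sum>i\<in>I. (z i)\<^sup>2) \<le> K * qform I A z" using c(2) main order_trans by blast
    then show "c / K * (\<Sum>i\<in>I. (z i)\<^sup>2) \<le> qform I A z" using K by (simp add: field_simps)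
  qed (use c K in simp)
qed

lemma finite_pos_lower_bound:
  fixes g :: "'i \<Rightarrow> real"
  assumes "finite I" "\<And>i. i \<in> I \<Longrightarrow> g i > 0"
  shows "\<exists>c>0. \<forall>i\<in>I. c \<le> g i"
  \<comment> \<open>The extra element 1 covers the empty index set.\<close>
  using assms by (intro exI[of _ "Min (insert 1 (g ` I))"]) auto

text \<open>The system is that of the transpose of a lower triangular \<open>C\<close>. In the
  equation belonging to the largest index with a nonzero \<open>y\<close>, only the diagonal term is
  left.\<close>

lemma upper_triangular_inj:
  fixes C :: "nat \<Rightarrow> nat \<Rightarrow> real"
  assumes upper: "\<And>i k. i < k \<Longrightarrow> C i k = 0" and diag: "\<And>i. i < m \<Longrightarrow> C i i \<noteq> 0"
    and ker: "\<And>s. s < m \<Longrightarrow> (\<Sum>h<m. C h s * y h) = 0" and "h < m"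
  shows "y h = 0"
proof (rule ccontr)
  assume "y h \<noteq> 0"
  let ?Z = "{h. h < m \<and> y h \<noteq> 0}"
  define h0 where "h0 = Max ?Z"
  have "h0 \<in> ?Z" unfolding h0_def using \<open>h < m\<close> \<open>y h \<noteq> 0\<close> by (intro Max_in) auto
  have above: "y h = 0" if "h0 < h" "h < m" for h
  proof (rule ccontr)
    assume "y h \<noteq> 0"
    then have "h \<le> h0" unfolding h0_def using that(2) by (intro Max_ge) auto
    then show False using that(1) by simp
  qed
  have "(\<Sum>h<m. C h h0 * y h) = (\<Sum>h<m. if h = h0 then C h0 h0 * y h0 else 0)"
  proof (intro sum.cong refl)
    fix h assume "h \<in> {..<m}"
    then show "C h h0 * y h = (if h = h0 then C h0 h0 * y h0 else 0)"
      using upper[of h h0] above[of h] by (cases h h0 rule: linorder_cases) auto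
  qed
  then show False using ker[of h0] diag[of h0] \<open>h0 \<in> ?Z\<close> by simp
qed

text \<open>A kernel vector of the diagonal block \<open>a\<close> extends to one of
  \<open>L\<close>: the components in the later blocks \<open>I'\<close> are found by solving there,
  which is possible because \<open>L\<close> restricted to \<open>I'\<close> is again injective and
  hence surjective.\<close>

lemma block_triangular_inj_imp_diag_inj:
  fixes L :: "nat \<Rightarrow> nat \<Rightarrow> real" and blk :: "nat \<Rightarrow> nat"
  assumes lower: "\<And>i j. i < m \<Longrightarrow> j < m \<Longrightarrow> blk i < blk j \<Longrightarrow> L i j = 0"
    and inj: "inj_matrix_on {..<m} L"
  shows "inj_matrix_on {..<m} (\<lambda>i j. if blk i = blk j then L i j else 0)"
  unfolding inj_matrix_on_def
proof (intro allI impI ballI)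
  fix y k
  assume ker: "\<forall>i\<in>{..<m}. (\<Sum>j<m. (if blk i = blk j then L i j else 0) * y j) = 0" and k: "k \<in> {..<m}"
  define a where "a = blk k"
  define I' where "I' = {i. i < m \<and> a < blk i}"
  define y' where "y' j = (if blk j = a then y j else 0)" for j
  have I': "finite I'" "I' \<subseteq> {..<m}" by (auto simp: I'_def)
  have ext: "(\<Sum>j<m. L i j * (if j \<in> I' then x j else 0)) = (\<Sum>j\<in>I'. L i j * x j)" for i x
    using I' by (simp add: if_distrib sum.If_cases Int_absorb1 cong: if_cong)
  have low: "(\<Sum>j\<in>I'. L i j * x j) = 0" if "i < m" "blk i \<le> a" for i x
    using that lower by (intro sum.neutral) (auto simp: I'_def)
  have "inj_matrix_on I' L"
    unfolding inj_matrix_on_def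
  proof (intro allI impI ballI)
    fix x j assume x: "\<forall>i\<in>I'. (\<Sum>j\<in>I'. L i j * x j) = 0" and j: "j \<in> I'"
    let ?x = "\<lambda>j. if j \<in> I' then x j else 0"
    have "(\<Sum>j<m. L i j * ?x j) = 0" if "i < m" for i
      unfolding ext using x low[OF that] that by (cases "a < blk i") (auto simp: I'_def)
    then have "?x j = 0" using j I' inj_matrix_onD[OF inj, of ?x j] by auto
    then show "x j = 0" using j by simp
  qed
  then obtain x where x: "\<And>i. i \<in> I' \<Longrightarrow> (\<Sum>j\<in>I'. L i j * x j) = - (\<Sum>j<m. L i j * y' j)"
    using inj_matrix_on_imp_surj[OF I'(1), of L "\<lambda>i. - (\<Sum>j<m. L i j * y' j)"] by blast
  define w where "w j = y' j + (if j \<in> I' then x j else 0)" for j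
  have "(\<Sum>j<m. L i j * w j) = 0" if i: "i < m" for i
  proof -
    have "(\<Sum>j<m. L i j * w j) = (\<Sum>j<m. L i j * y' j) + (\<Sum>j\<in>I'. L i j * x j)"
      by (simp add: w_def distrib_left sum.distrib ext)
    also have "\<dots> = 0"
    proof (cases "a < blk i")
      case True
      then show ?thesis using x[of i] i by (simp add: I'_def)
    next
      case False
      have "(\<Sum>j<m. L i j * y' j) = 0"
      proof (cases "blk i = a")
        case True
        have "(\<Sum>j<m. L i j * y' j) = (\<Sum>j<m. (if blk i = blk j then L i j else 0) * y j)"
          using True by (intro sum.cong refl) (auto simp: y'_def)
        then show ?thesis using ker i by simp
      next
        case False
        then show ?thesis using \<open>\<not> a < blk i\<close> lower i by (intro sum.neutral) (auto simp: y'_def)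
      qed
      then show ?thesis using low[OF i] False by simp
    qed
    finally show ?thesis .
  qed
  then have "w k = 0" using k inj_matrix_onD[OF inj, of w k] by auto
  then show "y k = 0" using k by (simp add: w_def y'_def a_def I'_def)
qed

text \<open>The matrix \<open>M\<close> of the error dynamics is block lower triangular with diagonal blocks
  \<open>C C\<^sup>T L\<close> up to positive factors. In the metric given by the diagonal blocks of \<open>L\<close> these are
  coercive because \<open>e\<^sup>T L C C\<^sup>T L e = |C\<^sup>T L e|\<^sup>2\<close>; weighting block \<open>a\<close> by \<open>\<eta>\<close> to the power
  \<open>2 a\<close> scales the blocks below the diagonal by positive powers of \<open>\<eta>\<close>, so for small
  \<open>\<eta>\<close> they are a small perturbation.\<close>
lemma block_triangular_lyapunov_matrix:
  fixes blk :: "nat \<Rightarrow> nat" and C CD L M :: "nat \<Rightarrow> nat \<Rightarrow> real" and \<kappa> :: "nat \<Rightarrow> real"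
  assumes blk_mono: "\<And>i j. i \<le> j \<Longrightarrow> j < m \<Longrightarrow> blk i \<le> blk j"
    and C_lower: "\<And>i k. i < k \<Longrightarrow> C i k = 0" and C_diag: "\<And>i. i < m \<Longrightarrow> C i i > 0"
    and CD: "\<And>i k. CD i k = (if blk i = blk k then C i k else 0)"
    and L_lower: "\<And>i j. i < m \<Longrightarrow> j < m \<Longrightarrow> blk i < blk j \<Longrightarrow> L i j = 0"
    and L_sym: "\<And>i j. i < m \<Longrightarrow> j < m \<Longrightarrow> blk i = blk j \<Longrightarrow> L i j = L j i"
    and L_psd: "\<And>a (x::nat \<Rightarrow> real). a \<in> blk ` {..<m} \<Longrightarrow>
        0 \<le> (\<Sum>i\<in>{i. i < m \<and> blk i = a}. \<Sum>j\<in>{j. j < m \<and> blk j = a}. x i * L i j * x j)"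
    and L_inj: "inj_matrix_on {..<m} L"
    and \<kappa>: "\<And>i. i < m \<Longrightarrow> \<kappa> (blk i) > 0"
    and M: "\<And>j k. j < m \<Longrightarrow> k < m \<Longrightarrow>
        M j k = (\<Sum>s<m. C j s * (\<Sum>h<m. CD h s * L h k * \<kappa> (blk k)))"
  shows "\<exists>P cP cM. (\<forall>i<m. \<forall>j<m. P i j = P j i) \<and>
      cP > 0 \<and> (\<forall>y. cP * (\<Sum>i<m. (y i)\<^sup>2) \<le> qform {..<m} P y) \<and>
      cM > 0 \<and> (\<forall>y. cM * (\<Sum>i<m. (y i)\<^sup>2) \<le> qform {..<m} (\<lambda>i k. \<Sum>j<m. P i j * M j k) y)"
proof -
  let ?I = "{..<m}"
  define LD where "LD i j = (if blk i = blk j then L i j else 0)" for i j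
  \<comment> \<open>\<open>T\<close> is the product of the transposed \<open>CD\<close> with the
    block diagonal part of \<open>L\<close>; the diagonal blocks of \<open>N\<close> turn out to be
    those of \<open>T^T T\<close> up to the factors \<kappa>.\<close>
  define T where "T s k = (\<Sum>h<m. CD h s * LD h k)" for s k
  define N where "N i k = (\<Sum>j<m. LD i j * M j k)" for i k
  define ND where "ND i k = (if blk i = blk k then N i k else 0)" for i k
  have LD_inj: "inj_matrix_on ?I LD"
    unfolding LD_def[abs_def] by (rule block_triangular_inj_imp_diag_inj[OF L_lower L_inj])
  have LD_sym: "LD i j = LD j i" if "i < m" "j < m" for i j
    using L_sym[OF that] by (auto simp: LD_def)
  have LD_psd: "0 \<le> qform ?I LD z" for z
  proof -
    let ?B = "\<lambda>a. {i. i < m \<and> blk i = a}"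
    have "qform ?I LD z = (\<Sum>i<m. \<Sum>j\<in>?B (blk i). z i * L i j * z j)"
      unfolding qform_def
    proof (rule sum.cong[OF refl])
      fix i
      have "(\<Sum>j<m. z i * LD i j * z j) = (\<Sum>j<m. if blk j = blk i then z i * L i j * z j else 0)"
        by (intro sum.cong) (auto simp: LD_def)
      then show "(\<Sum>j<m. z i * LD i j * z j) = (\<Sum>j\<in>?B (blk i). z i * L i j * z j)"
        by (simp add: sum.If_cases lessThan_def Collect_conj_eq)
    qed
    also have "\<dots> = (\<Sum>a\<in>blk ` ?I. \<Sum>i\<in>{i \<in> ?I. blk i = a}. \<Sum>j\<in>?B (blk i). z i * L i j * z j)"
      by (rule sum.group[symmetric]) auto
    also have "\<dots> = (\<Sum>a\<in>blk ` ?I. \<Sum>i\<in>?B a. \<Sum>j\<in>?B a. z i * L i j * z j)"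
      by (intro sum.cong) auto
    also have "\<dots> \<ge> 0" by (rule sum_nonneg) (rule L_psd)
    finally show ?thesis .
  qed
  obtain cL where cL: "cL > 0" "\<And>z. cL * (\<Sum>i<m. (z i)\<^sup>2) \<le> qform ?I LD z"
    using psd_inj_imp_coercive[of ?I LD] LD_sym LD_psd LD_inj by auto
  have "inj_matrix_on ?I T"
    unfolding inj_matrix_on_def
  proof (intro allI impI ballI)
    fix z k assume z: "\<forall>s\<in>?I. (\<Sum>k<m. T s k * z k) = 0" and k: "k \<in> ?I"
    have "(\<Sum>j<m. LD h j * z j) = 0" if "h < m" for h
    proof (rule upper_triangular_inj[of CD m "\<lambda>h. \<Sum>j<m. LD h j * z j"])
      show "CD i k = 0" if "i < k" for i k using that C_lower by (simp add: CD)
      show "CD i i \<noteq> 0" if "i < m" for i using C_diag[OF that] by (simp add: CD)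
      fix s assume s: "s < m"
      have "(\<Sum>h<m. CD h s * (\<Sum>j<m. LD h j * z j)) = (\<Sum>h<m. \<Sum>j<m. CD h s * LD h j * z j)"
        by (simp add: sum_distrib_left mult.assoc)
      also have "\<dots> = (\<Sum>j<m. T s j * z j)"
        by (subst sum.swap) (simp add: T_def sum_distrib_right)
      finally show "(\<Sum>h<m. CD h s * (\<Sum>j<m. LD h j * z j)) = 0" using z s by simp
    qed (rule that)
    then show "z k = 0" using k inj_matrix_onD[OF LD_inj, of z k] by auto
  qed
  then obtain cT where cT: "cT > 0" "\<And>z. cT * (\<Sum>i<m. (z i)\<^sup>2) \<le> (\<Sum>s<m. (\<Sum>k<m. T s k * z k)\<^sup>2)"
    using inj_matrix_on_bounded_below[of ?I T] by auto
  obtain \<kappa>0 where \<kappa>0: "\<kappa>0 > 0" "\<And>i. i < m \<Longrightarrow> \<kappa>0 \<le> \<kappa> (blk i)"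
    using finite_pos_lower_bound[of ?I "\<lambda>i. \<kappa> (blk i)"] \<kappa> by auto
  have T_off: "T s k = 0" if "blk s \<noteq> blk k" for s k
    unfolding T_def by (rule sum.neutral) (use that in \<open>auto simp: CD LD_def\<close>)
  have N_eq: "N i k = (\<Sum>j<m. \<Sum>s<m. \<Sum>h<m. LD i j * C j s * CD h s * L h k * \<kappa> (blk k))"
    if "k < m" for i k
    unfolding N_def using that by (intro sum.cong refl) (simp add: M sum_distrib_left mult.assoc)
  \<comment> \<open>Along a nonzero product the block index never increases: \<open>LD\<close> and
    \<open>CD\<close> stay in one block, \<open>C\<close> and \<open>L\<close> pass only to the same
    or an earlier block.\<close>
  have chain: "blk k \<le> blk i" if nz: "LD i j * C j s * CD h s * L h k \<noteq> 0"
    and lt: "j < m" "s < m" "h < m" "k < m" for i j s h k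
  proof -
    have "blk i = blk j" using nz by (auto simp: LD_def split: if_splits)
    moreover have "s \<le> j" using nz C_lower[of j s] by (cases "j < s") auto
    then have "blk s \<le> blk j" using blk_mono lt by blast
    moreover have "blk h = blk s" using nz by (auto simp: CD split: if_splits)
    moreover have "blk k \<le> blk h" using nz L_lower[of h k] lt by (cases "blk h < blk k") auto
    ultimately show ?thesis by simp
  qed
  have N_lower: "N i k = 0" if "k < m" "blk i < blk k" for i k
    unfolding N_eq[OF that(1)]
    by (intro sum.neutral ballI) (use chain that in \<open>force simp: not_le\<close>)
  \<comment> \<open>If both ends lie in the same block, so does every index in between. Hence
    \<open>C\<close> and \<open>L\<close> may be replaced by \<open>CD\<close> and
    \<open>LD\<close>, and the product becomes symmetric.\<close>
  have N_diag: "N i k = \<kappa> (blk k) * (\<Sum>s<m. T s i * T s k)" if ik: "i < m" "k < m" "blk i = blk k" for i k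
  proof -
    have "N i k = (\<Sum>j<m. \<Sum>s<m. \<Sum>h<m. LD j i * CD j s * CD h s * LD h k * \<kappa> (blk k))"
      unfolding N_eq[OF ik(2)]
    proof (intro sum.cong refl)
      fix j s h assume "j \<in> ?I" "s \<in> ?I" "h \<in> ?I"
      then have lt: "j < m" "s < m" "h < m" by auto
      have "LD i j * C j s * CD h s * L h k = LD i j * CD j s * CD h s * LD h k"
      proof (cases "blk i = blk j \<and> blk h = blk s")
        case False
        then show ?thesis by (auto simp: LD_def CD)
      next
        case True
        consider "blk j < blk s" | "blk s < blk j" | "blk s = blk j" by linarith
        then show ?thesis
        proof cases
          case 1
          then have "j < s" using blk_mono[of s j] lt by (cases "s \<le> j") auto
          then show ?thesis using C_lower by (simp add: CD)
        next
          case 2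
          then have "L h k = 0" using True ik lt by (intro L_lower) auto
          then show ?thesis by (simp add: LD_def)
        next
          case 3
          then show ?thesis using True ik by (simp add: LD_def CD)
        qed
      qed
      then show "LD i j * C j s * CD h s * L h k * \<kappa> (blk k) = LD j i * CD j s * CD h s * LD h k * \<kappa> (blk k)"
        using LD_sym[of i j] lt ik by simp
    qed
    also have "\<dots> = (\<Sum>s<m. \<Sum>j<m. \<Sum>h<m. LD j i * CD j s * CD h s * LD h k * \<kappa> (blk k))"
      by (rule sum.swap)
    also have "\<dots> = \<kappa> (blk k) * (\<Sum>s<m. T s i * T s k)"
      unfolding T_def sum_product by (simp add: sum_distrib_left mult_ac)
    finally show ?thesis .
  qed
  \<comment> \<open>Since \<open>T\<close> is block diagonal, the weight can be moved from the index
    \<open>k\<close> to the summation index \<open>s\<close>, which makes the form a weighted sum of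
    squares.\<close>
  have ND_eq: "ND i k = (\<Sum>s<m. \<kappa> (blk s) * (T s i * T s k))" if "i < m" "k < m" for i k
  proof (cases "blk i = blk k")
    case True
    then have "ND i k = (\<Sum>s<m. \<kappa> (blk k) * (T s i * T s k))"
      using N_diag that by (simp add: ND_def sum_distrib_left)
    also have "\<dots> = (\<Sum>s<m. \<kappa> (blk s) * (T s i * T s k))"
    proof (intro sum.cong refl)
      fix s
      show "\<kappa> (blk k) * (T s i * T s k) = \<kappa> (blk s) * (T s i * T s k)"
        using T_off[of s k] by (cases "blk s = blk k") auto
    qed
    finally show ?thesis .
  next
    case False
    have "(\<Sum>s<m. \<kappa> (blk s) * (T s i * T s k)) = 0"
    proof (rule sum.neutral, rule ballI)
      fix s
      show "\<kappa> (blk s) * (T s i * T s k) = 0"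
        using False T_off[of s i] T_off[of s k] by (cases "blk s = blk k") auto
    qed
    then show ?thesis using False by (simp add: ND_def)
  qed
  have ND_coer: "\<kappa>0 * cT * (\<Sum>i<m. (z i)\<^sup>2) \<le> qform ?I ND z" for z
  proof -
    have "qform ?I ND z = (\<Sum>i<m. \<Sum>k<m. \<Sum>s<m. \<kappa> (blk s) * ((T s i * z i) * (T s k * z k)))"
      unfolding qform_def
      by (intro sum.cong refl) (simp add: ND_eq sum_distrib_left sum_distrib_right mult_ac)
    also have "\<dots> = (\<Sum>i<m. \<Sum>s<m. \<Sum>k<m. \<kappa> (blk s) * ((T s i * z i) * (T s k * z k)))"
      by (intro sum.cong refl sum.swap)
    also have "\<dots> = (\<Sum>s<m. \<Sum>i<m. \<Sum>k<m. \<kappa> (blk s) * ((T s i * z i) * (T s k * z k)))"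
      by (rule sum.swap)
    also have "\<dots> = (\<Sum>s<m. \<kappa> (blk s) * (\<Sum>k<m. T s k * z k)\<^sup>2)"
      unfolding power2_eq_square sum_product by (simp add: sum_distrib_left)
    finally have "qform ?I ND z = (\<Sum>s<m. \<kappa> (blk s) * (\<Sum>k<m. T s k * z k)\<^sup>2)" .
    moreover have "\<dots> \<ge> (\<Sum>s<m. \<kappa>0 * (\<Sum>k<m. T s k * z k)\<^sup>2)"
      by (intro sum_mono mult_right_mono \<kappa>0(2)) auto
    moreover have "(\<Sum>s<m. \<kappa>0 * (\<Sum>k<m. T s k * z k)\<^sup>2) \<ge> \<kappa>0 * (cT * (\<Sum>i<m. (z i)\<^sup>2))"
      unfolding sum_distrib_left[symmetric] using \<kappa>0(1) cT(2) by (intro mult_left_mono) auto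
    ultimately show ?thesis by (simp add: mult.assoc)
  qed
  \<comment> \<open>Truncated subtraction is harmless: above the diagonal blocks the exponent is 0
    but \<open>N\<close> vanishes, on them the factor is 1, and below them it tends to 0.\<close>
  have "\<forall>\<^sub>F \<eta> in at_right 0. \<forall>z. \<kappa>0 * cT / 2 * (\<Sum>i<m. (z i)\<^sup>2)
      \<le> qform ?I (\<lambda>i k. \<eta> ^ (blk i - blk k) * N i k) z"
  proof (rule qform_coercive_perturb[OF _ _ ND_coer])
    fix i k assume ik: "i \<in> ?I" "k \<in> ?I"
    show "((\<lambda>\<eta>. \<eta> ^ (blk i - blk k) * N i k) \<longlongrightarrow> ND i k) (at_right 0)"
    proof (cases "blk i \<le> blk k")
      case True
      then have "(\<lambda>\<eta>::real. \<eta> ^ (blk i - blk k) * N i k) = (\<lambda>\<eta>. ND i k)"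
        using N_lower[of k i] ik by (auto simp: ND_def)
      then show ?thesis by simp
    next
      case False
      have "((\<lambda>\<eta>::real. \<eta> ^ (blk i - blk k) * N i k) \<longlongrightarrow> 0 ^ (blk i - blk k) * N i k) (at_right 0)"
        by (intro tendsto_intros)
      then show ?thesis using False by (simp add: ND_def power_0_left)
    qed
  qed (use \<kappa>0 cT in auto)
  moreover have "\<forall>\<^sub>F \<eta> in at_right (0::real). \<eta> > 0" by (rule eventually_at_right_less)
  ultimately have "\<forall>\<^sub>F \<eta> in at_right (0::real). \<eta> > 0 \<and> (\<forall>z. \<kappa>0 * cT / 2 * (\<Sum>i<m. (z i)\<^sup>2)
      \<le> qform ?I (\<lambda>i k. \<eta> ^ (blk i - blk k) * N i k) z)"
    by eventually_elim blast
  then obtain \<eta> :: real where \<eta>: "\<eta> > 0" "\<And>z. \<kappa>0 * cT / 2 * (\<Sum>i<m. (z i)\<^sup>2)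
      \<le> qform ?I (\<lambda>i k. \<eta> ^ (blk i - blk k) * N i k) z"
    using eventually_happens[of _ "at_right (0::real)"] trivial_limit_at_right_real by blast
  obtain \<omega> where \<omega>: "\<omega> > 0" "\<And>i. i < m \<Longrightarrow> \<omega> \<le> (\<eta> ^ blk i)\<^sup>2"
    using finite_pos_lower_bound[of ?I "\<lambda>i. (\<eta> ^ blk i)\<^sup>2"] \<eta>(1) by auto
  have scale: "\<omega> * (\<Sum>i<m. (y i)\<^sup>2) \<le> (\<Sum>i<m. (\<eta> ^ blk i * y i)\<^sup>2)" for y
    unfolding sum_distrib_left power_mult_distrib by (intro sum_mono mult_right_mono \<omega>(2)) auto
  \<comment> \<open>The weight depends on \<open>i\<close> alone, yet \<open>P\<close> is symmetric
    because \<open>LD\<close> vanishes between different blocks.\<close>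
  define P where "P i j = (\<eta> ^ blk i)\<^sup>2 * LD i j" for i j
  have "qform ?I P y = qform ?I LD (\<lambda>i. \<eta> ^ blk i * y i)" for y
    unfolding qform_def P_def by (intro sum.cong refl) (auto simp: LD_def power2_eq_square)
  then have P_coer: "cL * \<omega> * (\<Sum>i<m. (y i)\<^sup>2) \<le> qform ?I P y" for y
    using order_trans[OF mult_left_mono[OF scale less_imp_le[OF cL(1)]] cL(2)]
    by (simp only: mult.assoc)
  \<comment> \<open>Substituting the rescaled vector turns the weights into the powers of \<eta> of
    the perturbed form; \<open>\<omega>\<close> translates between the two norms.\<close>
  have PM: "qform ?I (\<lambda>i k. \<Sum>j<m. P i j * M j k) y
      = qform ?I (\<lambda>i k. \<eta> ^ (blk i - blk k) * N i k) (\<lambda>i. \<eta> ^ blk i * y i)" for y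
    unfolding qform_def
  proof (intro sum.cong refl)
    fix i k assume "i \<in> ?I" "k \<in> ?I"
    then have k: "k < m" by simp
    have "(\<Sum>j<m. P i j * M j k) = (\<eta> ^ blk i)\<^sup>2 * N i k"
      by (simp add: P_def N_def sum_distrib_left mult.assoc)
    moreover have "(\<eta> ^ blk i)\<^sup>2 * N i k = \<eta> ^ blk i * (\<eta> ^ (blk i - blk k) * N i k) * \<eta> ^ blk k"
    proof (cases "blk k \<le> blk i")
      case True
      then have "\<eta> ^ blk i = \<eta> ^ (blk i - blk k) * \<eta> ^ blk k" by (simp flip: power_add)
      then show ?thesis by (simp add: power2_eq_square mult_ac)
    next
      case False
      then show ?thesis using N_lower[OF k, of i] by simp
    qed
    ultimately show "y i * (\<Sum>j<m. P i j * M j k) * y k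
        = \<eta> ^ blk i * y i * (\<eta> ^ (blk i - blk k) * N i k) * (\<eta> ^ blk k * y k)"
      by (simp add: mult_ac)
  qed
  have PM_coer: "\<kappa>0 * cT / 2 * \<omega> * (\<Sum>i<m. (y i)\<^sup>2) \<le> qform ?I (\<lambda>i k. \<Sum>j<m. P i j * M j k) y" for y
    unfolding PM
    using order_trans[OF mult_left_mono[OF scale, of "\<kappa>0 * cT / 2"] \<eta>(2)] \<kappa>0(1) cT(1)
    by (simp only: mult.assoc) simp
  have "P i j = P j i" if "i < m" "j < m" for i j
    using LD_sym[OF that] by (auto simp: P_def LD_def)
  then show ?thesis
    using P_coer PM_coer cL(1) \<omega>(1) \<kappa>0(1) cT(1)
    by (intro exI[of _ P] exI[of _ "cL * \<omega>"] exI[of _ "\<kappa>0 * cT / 2 * \<omega>"]) auto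
qed

section \<open>Gram-Schmidt and continuity of matrix operations\<close>

lemma length_gs_vs [simp]: "length (gs_vs j n) = n"
  by (induction n) auto

lemma gs_vs_nth: "k < n \<Longrightarrow> gs_vs j n ! k = gs_v j k"
proof (induction n)
  case (Suc n)
  show ?case
  proof (cases "k = n")
    case True
    then show ?thesis by (simp add: gs_v_def)
  next
    case False
    then have "k < n" using Suc.prems by simp
    then show ?thesis using Suc.IH by (simp add: nth_append)
  qed
qed simp

text \<open>The default 0 of \<open>gs_hat\<close> at a vanishing pivot allows the sum to run over
  all earlier indices.\<close>

lemma gs_v_eq: "gs_v j i = j i - (\<Sum>k<i. (gs_hat j k \<bullet> j i) *\<^sub>R gs_hat j k)"
proof -
  let ?w = "\<lambda>k. gs_vs j i ! k"
  have "gs_v j i = j i - (\<Sum>k\<in>{k. k < i \<and> norm (?w k) > 0}.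
               ((?w k /\<^sub>R norm (?w k)) \<bullet> j i) *\<^sub>R (?w k /\<^sub>R norm (?w k)))"
    by (simp only: gs_v_def gs_vs.simps(2)) (simp add: nth_append del: zero_less_norm_iff)
  also have "(\<Sum>k\<in>{k. k < i \<and> norm (?w k) > 0}. ((?w k /\<^sub>R norm (?w k)) \<bullet> j i) *\<^sub>R (?w k /\<^sub>R norm (?w k)))
      = (\<Sum>k\<in>{k. k < i \<and> norm (?w k) > 0}. (gs_hat j k \<bullet> j i) *\<^sub>R gs_hat j k)"
    by (intro sum.cong refl) (simp add: gs_vs_nth gs_hat_def gs_cdiag_def)
  also have "\<dots> = (\<Sum>k<i. (gs_hat j k \<bullet> j i) *\<^sub>R gs_hat j k)"
    by (intro sum.mono_neutral_left) (auto simp: gs_vs_nth gs_hat_def gs_cdiag_def)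
  finally show ?thesis .
qed

lemma gs_v_hat: "gs_v j i = gs_cdiag j i *\<^sub>R gs_hat j i"
  by (auto simp: gs_hat_def gs_cdiag_def)

lemma gs_hat_self: "gs_hat j i \<bullet> gs_hat j i = (if gs_cdiag j i > 0 then 1 else 0)"
  by (auto simp: gs_hat_def gs_cdiag_def dot_square_norm power2_eq_square)

lemma gs_v_orthogonal: "k < i \<Longrightarrow> gs_hat j k \<bullet> gs_v j i = 0"
proof (induction i arbitrary: k rule: less_induct)
  case (less i)
  have orth: "gs_hat j k \<bullet> gs_hat j h = 0" if "h < i" "h \<noteq> k" for h
  proof (cases "h < k")
    case True
    then have "gs_hat j h \<bullet> gs_v j k = 0" using less by simp
    then show ?thesis by (auto simp: gs_hat_def inner_commute)
  next
    case False
    then have "gs_hat j k \<bullet> gs_v j h = 0" using less that by simp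
    then show ?thesis by (auto simp: gs_hat_def)
  qed
  have "gs_hat j k \<bullet> (\<Sum>h<i. (gs_hat j h \<bullet> j i) *\<^sub>R gs_hat j h)
      = (\<Sum>h<i. if h = k then (gs_hat j k \<bullet> j i) * (gs_hat j k \<bullet> gs_hat j k) else 0)"
    unfolding inner_sum_right by (intro sum.cong refl) (use orth in auto)
  also have "\<dots> = (gs_hat j k \<bullet> j i) * (gs_hat j k \<bullet> gs_hat j k)" using less.prems by simp
  also have "\<dots> = gs_hat j k \<bullet> j i"
  proof (cases "gs_cdiag j k > 0")
    case True
    then show ?thesis by (simp add: gs_hat_self)
  qed (simp add: gs_hat_def)
  finally show ?case by (simp add: gs_v_eq[of j i] inner_diff_right)
qed

lemma gs_hat_orthogonal: "i \<noteq> k \<Longrightarrow> gs_hat j i \<bullet> gs_hat j k = 0"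
  by (cases i k rule: linorder_cases)
    (use gs_v_orthogonal[of i k j] gs_v_orthogonal[of k i j] in \<open>auto simp: gs_hat_def inner_commute\<close>)

text \<open>This is the factorization of \<open>J\<close> into \<open>C\<close> and the
  orthonormalized rows, read off by pairing with \<open>gs_hat\<close>. It persists at a vanishing
  pivot \<open>i\<close>, where both sides are 0.\<close>

lemma gs_row_hat: "j k \<bullet> gs_hat j i = gs_c j k i"
proof -
  have row: "j k = gs_cdiag j k *\<^sub>R gs_hat j k + (\<Sum>h<k. (gs_hat j h \<bullet> j k) *\<^sub>R gs_hat j h)"
    using gs_v_eq[of j k] gs_v_hat[of j k] by (simp add: algebra_simps)
  consider "i < k" | "i = k" | "k < i" by linarith
  then show ?thesis
  proof cases
    case 1
    then show ?thesis by (auto simp: gs_c_def inner_commute) (simp add: gs_hat_def)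
  next
    case 2
    have "j k \<bullet> gs_hat j k = gs_cdiag j k * (gs_hat j k \<bullet> gs_hat j k)"
      by (subst row) (simp add: inner_add_left inner_sum_left gs_hat_orthogonal)
    then show ?thesis using 2 by (auto simp: gs_c_def gs_hat_self gs_cdiag_def)
  next
    case 3
    then show ?thesis
      by (subst row) (simp add: inner_add_left inner_sum_left gs_hat_orthogonal gs_c_def)
  qed
qed

lemma gs_c_upper: "i < k \<Longrightarrow> gs_c j i k = 0"
  by (simp add: gs_c_def)

lemma gs_hat_in_span:
  assumes "i < m"
  shows "gs_hat j i \<in> span (j ` {..<m})"
  using assms
proof (induction i rule: less_induct)
  case (less i)
  have "gs_v j i \<in> span (j ` {..<m})"
    unfolding gs_v_eq
  proof (intro span_diff span_sum span_scale)
    show "j i \<in> span (j ` {..<m})" using less.prems by (intro span_base) auto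
  qed (use less in auto)
  then show ?case by (auto simp: gs_hat_def span_scale span_zero)
qed

text \<open>Positive pivots yield \<open>m\<close> orthonormal vectors in the span of the rows. This
  gives access to the continuity of \<open>L\<close>, which is assumed only at full rank.\<close>

lemma dim_rows_eq:
  fixes j :: "nat \<Rightarrow> 'a::euclidean_space"
  assumes pos: "\<And>i. i < m \<Longrightarrow> gs_cdiag j i > 0"
  shows "dim (span (j ` {..<m})) = m"
proof (rule antisym)
  have "dim (j ` {..<m}) \<le> card (j ` {..<m})" by (rule dim_le_card') simp
  also have "\<dots> \<le> m" using card_image_le[of "{..<m}" j] by simp
  finally show "dim (span (j ` {..<m})) \<le> m" by simp
  let ?H = "gs_hat j ` {..<m}"
  have ne: "gs_hat j i \<noteq> 0" if "i < m" for i using gs_hat_self[of j i] pos[OF that] by auto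
  have inj: "inj_on (gs_hat j) {..<m}"
    by (rule inj_onI) (metis gs_hat_orthogonal inner_eq_zero_iff lessThan_iff ne)
  have "independent ?H"
    by (rule pairwise_orthogonal_independent)
      (use ne in \<open>auto simp: pairwise_def orthogonal_def intro: gs_hat_orthogonal\<close>)
  then have "card ?H \<le> dim (span (j ` {..<m}))"
    by (intro independent_card_le_dim) (auto intro: gs_hat_in_span)
  then show "m \<le> dim (span (j ` {..<m}))" using card_image[OF inj] by simp
qed

text \<open>Both limits go through one induction, since each \<open>gs_v\<close> uses the earlier
  \<open>gs_hat\<close>. Positivity of the pivots is asked only in the limit, where it makes the
  normalization continuous; along the filter it then holds eventually.\<close>

lemma gs_v_tendsto:
  fixes J :: "'b \<Rightarrow> nat \<Rightarrow> 'a::euclidean_space"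
  assumes lim: "\<And>i. i < m \<Longrightarrow> ((\<lambda>q. J q i) \<longlongrightarrow> j i) F"
    and pos: "\<And>i. i < m \<Longrightarrow> gs_cdiag j i > 0" and "i < m"
  shows "((\<lambda>q. gs_v (J q) i) \<longlongrightarrow> gs_v j i) F \<and> ((\<lambda>q. gs_hat (J q) i) \<longlongrightarrow> gs_hat j i) F"
  using \<open>i < m\<close>
proof (induction i rule: less_induct)
  case (less i)
  have v: "((\<lambda>q. gs_v (J q) i) \<longlongrightarrow> gs_v j i) F"
    unfolding gs_v_eq using less by (intro tendsto_intros lim) auto
  have cpos: "gs_cdiag j i > 0" using pos less.prems by blast
  have c: "((\<lambda>q. gs_cdiag (J q) i) \<longlongrightarrow> gs_cdiag j i) F"
    unfolding gs_cdiag_def by (intro tendsto_norm v)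
  have "((\<lambda>q. gs_v (J q) i /\<^sub>R gs_cdiag (J q) i) \<longlongrightarrow> gs_v j i /\<^sub>R gs_cdiag j i) F"
    using cpos by (intro tendsto_intros v c) auto
  moreover have "\<forall>\<^sub>F q in F. gs_v (J q) i /\<^sub>R gs_cdiag (J q) i = gs_hat (J q) i"
    using order_tendstoD(1)[OF c cpos] by eventually_elim (simp add: gs_hat_def)
  ultimately have "((\<lambda>q. gs_hat (J q) i) \<longlongrightarrow> gs_v j i /\<^sub>R gs_cdiag j i) F"
    by (rule Lim_transform_eventually)
  then show ?case using v cpos by (simp add: gs_hat_def)
qed

lemmas gs_hat_tendsto = gs_v_tendsto[THEN conjunct2]

lemma gs_cdiag_tendsto:
  fixes J :: "'b \<Rightarrow> nat \<Rightarrow> 'a::euclidean_space"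
  assumes "\<And>i. i < m \<Longrightarrow> ((\<lambda>q. J q i) \<longlongrightarrow> j i) F"
    and "\<And>i. i < m \<Longrightarrow> gs_cdiag j i > 0" and "i < m"
  shows "((\<lambda>q. gs_cdiag (J q) i) \<longlongrightarrow> gs_cdiag j i) F"
  unfolding gs_cdiag_def by (intro tendsto_norm gs_v_tendsto[OF assms, THEN conjunct1])

lemma gs_c_tendsto:
  fixes J :: "'b \<Rightarrow> nat \<Rightarrow> 'a::euclidean_space"
  assumes "\<And>i. i < m \<Longrightarrow> ((\<lambda>q. J q i) \<longlongrightarrow> j i) F"
    and "\<And>i. i < m \<Longrightarrow> gs_cdiag j i > 0" and "i < m" "k < m"
  shows "((\<lambda>q. gs_c (J q) i k) \<longlongrightarrow> gs_c j i k) F"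
  unfolding gs_row_hat[symmetric]
  by (intro tendsto_inner assms(1)[OF assms(3)] gs_hat_tendsto[OF assms(1,2,4)])

section \<open>Continuity of determinants, inverses and matrix products\<close>

lemma tendsto_det:
  fixes A :: "'b \<Rightarrow> real^'n^'n"
  assumes "\<And>i j. ((\<lambda>x. A x $ i $ j) \<longlongrightarrow> B $ i $ j) F"
  shows "((\<lambda>x. det (A x)) \<longlongrightarrow> det B) F"
  unfolding det_def by (intro tendsto_intros assms)

lemma matrix_inv_mult:
  fixes M :: "real^'n^'n"
  assumes "invertible M"
  shows "M ** matrix_inv M = mat 1" "matrix_inv M ** M = mat 1"
  using assms someI_ex[of "\<lambda>A'. M ** A' = mat 1 \<and> A' ** M = mat 1"]
  by (auto simp: invertible_def matrix_inv_def)

text \<open>By Cramer's rule each entry of the inverse is a quotient of determinants, hence a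
  continuous function of the entries where the denominator does not vanish.\<close>

lemma tendsto_matrix_inv:
  fixes A :: "'b \<Rightarrow> real^'n^'n"
  assumes lim: "(A \<longlongrightarrow> B) F" and inv: "\<And>x. invertible (A x)" "invertible B"
  shows "((\<lambda>x. matrix_inv (A x)) \<longlongrightarrow> matrix_inv B) F"
proof -
  have entry: "matrix_inv M $ k $ l = det (\<chi> i j. if j = k then axis l 1 $ i else M $ i $ j) / det M"
    if M: "invertible M" for M :: "real^'n^'n" and k l
  proof -
    have "M *v (matrix_inv M *v axis l 1) = axis l 1"
      using matrix_inv_mult(1)[OF M] by (simp add: matrix_vector_mul_assoc)
    then have "matrix_inv M *v axis l 1 = (\<chi> k. det (\<chi> i j. if j = k then axis l 1 $ i else M $ i $ j) / det M)"
      using cramer[of M] M invertible_det_nz by blast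
    moreover have "(matrix_inv M *v axis l 1) $ k = matrix_inv M $ k $ l"
      by (simp add: matrix_vector_mul_component inner_axis)
    ultimately show ?thesis by simp
  qed
  have comp: "((\<lambda>x. A x $ i $ j) \<longlongrightarrow> B $ i $ j) F" for i j
    using lim by (intro tendsto_vec_nth)
  show ?thesis
  proof (rule vec_tendstoI, rule vec_tendstoI)
    fix k l
    have "((\<lambda>x. det (\<chi> i j. if j = k then axis l 1 $ i else A x $ i $ j) / det (A x)) \<longlongrightarrow>
       det (\<chi> i j. if j = k then axis l 1 $ i else B $ i $ j) / det B) F"
    proof (intro tendsto_divide tendsto_det comp)
      show "det B \<noteq> 0" using inv(2) invertible_det_nz by blast
    qed (auto intro: comp)
    then show "((\<lambda>x. matrix_inv (A x) $ k $ l) \<longlongrightarrow> matrix_inv B $ k $ l) F"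
      by (simp add: entry inv)
  qed
qed

lemma tendsto_vector_matrix_mult:
  fixes A :: "'b \<Rightarrow> real^'n^'m"
  assumes "(v \<longlongrightarrow> w) F" "(A \<longlongrightarrow> B) F"
  shows "((\<lambda>x. v x v* A x) \<longlongrightarrow> w v* B) F"
  unfolding vector_matrix_mult_def
  by (rule vec_tendstoI) (use assms in \<open>auto intro!: tendsto_intros\<close>)

lemma tendsto_matrix_vector_mult:
  fixes A :: "'b \<Rightarrow> real^'n^'m"
  assumes "(v \<longlongrightarrow> w) F" "(A \<longlongrightarrow> B) F"
  shows "((\<lambda>x. A x *v v x) \<longlongrightarrow> B *v w) F"
  unfolding matrix_vector_mult_def
  by (rule vec_tendstoI) (use assms in \<open>auto intro!: tendsto_intros\<close>)

section \<open>Stability of the closed loop\<close>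

lemma isCont_tendsto_nhds:
  fixes g :: "'a::t2_space \<Rightarrow> 'b::topological_space"
  shows "isCont g q \<Longrightarrow> (g \<longlongrightarrow> g q) (nhds q)"
  unfolding isCont_def by (simp only: tendsto_at_iff_tendsto_nhds)

text \<open>The components are packed into the single map
  \<open>\<Sum>i<m. e z i *\<^sub>R G i\<close>, which avoids a vector type of dimension
  \<open>m\<close>. Its derivative \<open>g\<close> is \<open>G^T G\<close>, injective and thus
  bounded below, and the first-order error cannot cancel it near \<open>q\<close>.\<close>

lemma has_derivative_injective_isolated_zero:
  fixes e :: "'a::euclidean_space \<Rightarrow> nat \<Rightarrow> real" and G :: "nat \<Rightarrow> 'a"
  assumes der: "\<And>i. i < m \<Longrightarrow> ((\<lambda>z. e z i) has_derivative (\<lambda>h. G i \<bullet> h)) (at q)"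
    and zero: "\<And>i. i < m \<Longrightarrow> e q i = 0"
    and inj: "\<And>h. (\<And>i. i < m \<Longrightarrow> G i \<bullet> h = 0) \<Longrightarrow> h = 0"
  shows "\<forall>\<^sub>F z in nhds q. (\<forall>i<m. e z i = 0) \<longrightarrow> z = q"
proof -
  define g where "g h = (\<Sum>i<m. (G i \<bullet> h) *\<^sub>R G i)" for h
  have lin: "linear g"
    unfolding g_def
    by (rule linearI) (simp_all add: inner_add_right scaleR_add_left sum.distrib scaleR_sum_right)
  have "h = 0" if "g h = 0" for h
  proof (rule inj)
    fix i assume i: "i < m"
    have "(\<Sum>i<m. (G i \<bullet> h)\<^sup>2) = h \<bullet> g h"
      by (simp add: g_def inner_sum_right power2_eq_square inner_commute)
    then have "(\<Sum>i<m. (G i \<bullet> h)\<^sup>2) = 0" using that by simp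
    then show "G i \<bullet> h = 0" using i by (simp add: sum_nonneg_eq_0_iff)
  qed
  then have "inj g" using lin by (simp add: linear_injective_0)
  then obtain b where b: "b > 0" "\<And>h. b * norm h \<le> norm (g h)"
    using linear_inj_bounded_below_pos[OF lin] by metis
  have "((\<lambda>z. \<Sum>i<m. e z i *\<^sub>R G i) has_derivative g) (at q)"
    unfolding g_def by (intro has_derivative_sum has_derivative_scaleR_left der) auto
  then obtain d where d: "d > 0" "\<And>z. norm (z - q) < d \<Longrightarrow>
      norm ((\<Sum>i<m. e z i *\<^sub>R G i) - (\<Sum>i<m. e q i *\<^sub>R G i) - g (z - q)) \<le> b / 2 * norm (z - q)"
    unfolding has_derivative_at_alt using b(1) by (metis half_gt_zero)
  have "z = q" if "dist z q < d" "\<forall>i<m. e z i = 0" for z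
  proof -
    have "norm (g (z - q)) \<le> b / 2 * norm (z - q)"
      using d(2)[of z] that zero by (simp add: dist_norm)
    then have "b * norm (z - q) \<le> b / 2 * norm (z - q)" using b(2)[of "z - q"] by linarith
    then have "norm (z - q) \<le> 0" using b(1) by (simp add: field_simps)
    then show ?thesis by simp
  qed
  then show ?thesis unfolding eventually_nhds_metric using d(1) by blast
qed

text \<open>The closed loop reduced to linear algebra: with \<open>V = e^T P e\<close> the
  derivative along \<open>u\<close> is \<open>- 2 e^T P (G U) e\<close>. Coercivity is required only
  at \<open>q\<close> and spreads to a neighbourhood by perturbation.\<close>

lemma quadratic_lyapunov_stability:
  fixes u :: "'a::euclidean_space \<Rightarrow> 'a" and e :: "'a \<Rightarrow> nat \<Rightarrow> real"
    and G U :: "'a \<Rightarrow> nat \<Rightarrow> 'a" and P :: "nat \<Rightarrow> nat \<Rightarrow> real"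
  assumes u_eq: "\<And>z. u z = - (\<Sum>j<m. e z j *\<^sub>R U z j)"
    and U_cont: "\<forall>\<^sub>F z in nhds q. \<forall>j<m. isCont (\<lambda>z. U z j) z"
    and e_deriv: "\<And>z i. i < m \<Longrightarrow> ((\<lambda>z. e z i) has_derivative (\<lambda>h. G z i \<bullet> h)) (at z)"
    and G_cont: "\<And>i. i < m \<Longrightarrow> isCont (\<lambda>z. G z i) q"
    and zero: "\<And>i. i < m \<Longrightarrow> e q i = 0"
    and P_sym: "\<And>i j. i < m \<Longrightarrow> j < m \<Longrightarrow> P i j = P j i"
    and cP: "cP > 0" "\<And>y. cP * (\<Sum>i<m. (y i)\<^sup>2) \<le> qform {..<m} P y"
    and cM: "cM > 0" "\<And>y. cM * (\<Sum>i<m. (y i)\<^sup>2)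
        \<le> qform {..<m} (\<lambda>i k. \<Sum>j<m. P i j * (G q j \<bullet> U q k)) y"
  shows "semistable_eq u q"
    and "(\<And>h. (\<And>i. i < m \<Longrightarrow> G q i \<bullet> h = 0) \<Longrightarrow> h = 0) \<Longrightarrow> asymp_stable_eq u q"
proof -
  define V where "V z = qform {..<m} P (e z)" for z
  \<comment> \<open>The factor 2 merges the two terms of the product rule, by symmetry of
    \<open>P\<close>.\<close>
  define V' where "V' z h = 2 * (\<Sum>i<m. \<Sum>j<m. e z i * P i j * (G z j \<bullet> h))" for z h
  define N where "N z i k = (\<Sum>j<m. P i j * (G z j \<bullet> U z k))" for z i k
  let ?E = "\<lambda>z. \<Sum>i<m. (e z i)\<^sup>2"
  have E_nonneg: "0 \<le> ?E z" for z by (intro sum_nonneg) auto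
  define KP where "KP = 1 + (\<Sum>i<m. \<Sum>j<m. \<bar>P i j\<bar>)"
  have KP: "KP > 0" unfolding KP_def by (intro add_pos_nonneg sum_nonneg) auto
  have V_le: "V z \<le> KP * ?E z" for z
  proof -
    have "V z \<le> (\<Sum>i<m. \<Sum>j<m. \<bar>P i j\<bar>) * ?E z"
      unfolding V_def using abs_qform_le[of "{..<m}" P "e z"] by simp
    also have "\<dots> \<le> KP * ?E z" unfolding KP_def using E_nonneg by (intro mult_right_mono) auto
    finally show ?thesis .
  qed
  have V_ge: "cP * ?E z \<le> V z" for z unfolding V_def by (rule cP(2))
  have V_nonneg: "0 \<le> V z" for z
    using V_ge[of z] E_nonneg[of z] cP(1) by (meson mult_nonneg_nonneg less_imp_le order_trans)
  have V_zero: "e z i = 0" if "V z = 0" "i < m" for z i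
  proof -
    have "?E z \<le> 0" using V_ge[of z] cP(1) that(1) by (simp add: mult_le_0_iff)
    then have "?E z = 0" using E_nonneg[of z] by simp
    then show ?thesis using that(2) by (simp add: sum_nonneg_eq_0_iff)
  qed
  have V_deriv: "(V has_derivative V' z) (at z)" for z
  proof -
    have "((\<lambda>z. \<Sum>i<m. \<Sum>j<m. e z i * P i j * e z j) has_derivative
       (\<lambda>h. \<Sum>i<m. \<Sum>j<m. e z i * P i j * (G z j \<bullet> h) + (G z i \<bullet> h) * P i j * e z j)) (at z)"
      by (intro has_derivative_sum has_derivative_mult has_derivative_mult_left e_deriv) auto
    moreover have "(\<Sum>i<m. \<Sum>j<m. e z i * P i j * (G z j \<bullet> h) + (G z i \<bullet> h) * P i j * e z j) = V' z h" for h
    proof -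
      have "(\<Sum>i<m. \<Sum>j<m. (G z i \<bullet> h) * P i j * e z j) = (\<Sum>j<m. \<Sum>i<m. e z j * P j i * (G z i \<bullet> h))"
        by (subst sum.swap) (intro sum.cong refl, simp add: P_sym mult_ac)
      then show ?thesis by (simp add: sum.distrib V'_def)
    qed
    ultimately show ?thesis by (simp add: V_def[abs_def] qform_def)
  qed
  have V'_u: "V' z (u z) = - 2 * qform {..<m} (N z) (e z)" for z
  proof -
    have "(\<Sum>j<m. e z i * P i j * (G z j \<bullet> u z)) = - (\<Sum>k<m. e z i * N z i k * e z k)" for i
    proof -
      have "(\<Sum>j<m. e z i * P i j * (G z j \<bullet> u z))
          = - (\<Sum>j<m. \<Sum>k<m. e z i * (P i j * (G z j \<bullet> U z k)) * e z k)"
        by (simp add: u_eq inner_sum_right sum_distrib_left mult_ac flip: sum_negf)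
      also have "(\<Sum>j<m. \<Sum>k<m. e z i * (P i j * (G z j \<bullet> U z k)) * e z k) = (\<Sum>k<m. e z i * N z i k * e z k)"
        by (subst sum.swap) (simp add: N_def sum_distrib_left sum_distrib_right)
      finally show ?thesis .
    qed
    then show ?thesis by (simp add: V'_def qform_def sum_negf)
  qed
  define B where "B = (\<Sum>j<m. norm (U q j) + 1)"
  have Uq: "isCont (\<lambda>z. U z j) q" if "j < m" for j
    using eventually_nhds_x_imp_x[OF U_cont] that by simp
  have ev_U: "\<forall>\<^sub>F z in nhds q. \<forall>j\<in>{..<m}. norm (U z j) < norm (U q j) + 1"
  proof (rule eventually_ball_finite, simp, rule ballI)
    fix j assume "j \<in> {..<m}"
    then have "((\<lambda>z. norm (U z j)) \<longlongrightarrow> norm (U q j)) (nhds q)"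
      using Uq by (intro tendsto_norm isCont_tendsto_nhds) simp
    then show "\<forall>\<^sub>F z in nhds q. norm (U z j) < norm (U q j) + 1"
      by (rule order_tendstoD) simp
  qed
  have ev_N: "\<forall>\<^sub>F z in nhds q. \<forall>y. cM / 2 * (\<Sum>i<m. (y i)\<^sup>2) \<le> qform {..<m} (N z) y"
  proof (rule qform_coercive_perturb[where A="N q"])
    fix i k assume ik: "i \<in> {..<m}" "k \<in> {..<m}"
    have "isCont (\<lambda>z. N z i k) q"
      unfolding N_def by (intro continuous_intros) (use Uq G_cont ik in auto)
    then show "((\<lambda>z. N z i k) \<longlongrightarrow> N q i k) (nhds q)"
      by (rule isCont_tendsto_nhds)
  qed (use cM in \<open>auto simp: N_def[abs_def]\<close>)
  \<comment> \<open>All requirements are collected in a pointwise predicate, so that one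
    verification covers the two neighbourhoods chosen for the two conclusions.\<close>
  define Q where "Q z \<longleftrightarrow> (\<forall>j<m. isCont (\<lambda>z. U z j) z) \<and> (\<forall>j\<in>{..<m}. norm (U z j) < norm (U q j) + 1)
     \<and> (\<forall>y. cM / 2 * (\<Sum>i<m. (y i)\<^sup>2) \<le> qform {..<m} (N z) y)" for z
  have evQ: "\<forall>\<^sub>F z in nhds q. Q z"
    unfolding Q_def using U_cont ev_U ev_N by eventually_elim blast
  have B_nonneg: "0 \<le> B" unfolding B_def by (intro sum_nonneg) auto
  \<comment> \<open>With \<open>E\<close> the squared error, the derivative is at most
    \<open>- cM * E\<close>, and \<open>V \<le> KP * E\<close>, so the decay rate
    \<open>2 * c\<close> is \<open>cM / KP\<close>. For the speed, each error component is at most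
    \<open>sqrt (V z / cP)\<close>, each of the \<open>m\<close> columns at most
    \<open>B\<close>.\<close>
  have lyap: "lyapunov_ball u V V' S (cM / (2 * KP)) (real m * B / sqrt cP)" if S: "\<And>z. z \<in> S \<Longrightarrow> Q z" for S
  proof
    show "0 < cM / (2 * KP)" using cM(1) KP by simp
    show "0 \<le> real m * B / sqrt cP" using B_nonneg cP(1) by simp
    show "continuous_on S u"
    proof (rule continuous_at_imp_continuous_on, rule ballI)
      fix z assume "z \<in> S"
      then have "isCont (\<lambda>z. U z j) z" if "j < m" for j using S that by (auto simp: Q_def)
      moreover have "isCont (\<lambda>z. e z j) z" if "j < m" for j
        using e_deriv[OF that] has_derivative_continuous by blast
      ultimately show "isCont u z"
        unfolding u_eq[abs_def] by (intro continuous_intros) auto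
    qed
    fix z assume z: "z \<in> S"
    show "(V has_derivative V' z) (at z)" by (rule V_deriv)
    show "0 \<le> V z" by (rule V_nonneg)
    have "V z * (cM / KP) \<le> KP * ?E z * (cM / KP)"
      using V_le[of z] cM(1) KP by (intro mult_right_mono) auto
    also have "\<dots> = cM * ?E z" using KP by simp
    also have "\<dots> \<le> 2 * qform {..<m} (N z) (e z)"
    proof -
      have "cM / 2 * ?E z \<le> qform {..<m} (N z) (e z)" using S[OF z] unfolding Q_def by blast
      then show ?thesis by simp
    qed
    finally show "V' z (u z) \<le> - (2 * (cM / (2 * KP))) * V z"
      unfolding V'_u by (simp add: algebra_simps)
    have "norm (u z) \<le> (\<Sum>j<m. norm (e z j *\<^sub>R U z j))"
      unfolding u_eq norm_minus_cancel by (rule norm_sum)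
    also have "\<dots> \<le> (\<Sum>j<m. sqrt (V z) / sqrt cP * B)"
    proof (rule sum_mono)
      fix j assume j: "j \<in> {..<m}"
      have "(e z j)\<^sup>2 \<le> ?E z" using j by (intro member_le_sum) auto
      also have "\<dots> \<le> V z / cP" using V_ge[of z] cP(1) by (simp add: field_simps)
      finally have "\<bar>e z j\<bar> \<le> sqrt (V z / cP)" by (metis real_sqrt_abs real_sqrt_le_mono)
      moreover have "norm (U z j) \<le> B"
      proof -
        have "norm (U z j) \<le> norm (U q j) + 1" using S[OF z] j by (force simp: Q_def)
        also have "\<dots> \<le> B" unfolding B_def using j by (intro member_le_sum) auto
        finally show ?thesis .
      qed
      ultimately show "norm (e z j *\<^sub>R U z j) \<le> sqrt (V z) / sqrt cP * B"
        using V_nonneg[of z] cP(1) unfolding norm_scaleR real_sqrt_divide by (intro mult_mono) auto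
    qed
    finally show "norm (u z) \<le> real m * B / sqrt cP * sqrt (V z)" by (simp add: mult_ac)
  qed
  have Vq: "V q = 0" unfolding V_def qform_def using zero by simp
  obtain S where S: "open S" "q \<in> S" "\<And>z. z \<in> S \<Longrightarrow> Q z"
    using evQ unfolding eventually_nhds by blast
  show "semistable_eq u q"
    by (rule lyapunov_ball.zero_semistable[OF lyap[of S]]) (use S Vq in \<open>auto simp: interior_open\<close>)
  assume inj: "\<And>h. (\<And>i. i < m \<Longrightarrow> G q i \<bullet> h = 0) \<Longrightarrow> h = 0"
  have "\<forall>\<^sub>F z in nhds q. (\<forall>i<m. e z i = 0) \<longrightarrow> z = q"
    by (rule has_derivative_injective_isolated_zero[OF e_deriv zero inj])
  then have "\<forall>\<^sub>F z in nhds q. Q z \<and> ((\<forall>i<m. e z i = 0) \<longrightarrow> z = q)"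
    using evQ by eventually_elim blast
  then obtain S' where S': "open S'" "q \<in> S'"
      "\<forall>z\<in>S'. Q z \<and> ((\<forall>i<m. e z i = 0) \<longrightarrow> z = q)"
    unfolding eventually_nhds by (elim exE conjE)
  show "asymp_stable_eq u q"
  proof (rule lyapunov_ball.isolated_zero_asymp_stable[OF lyap[of S']])
    show "Q z" if "z \<in> S'" for z using S' that by blast
    show "q \<in> interior S'" using S' by (simp add: interior_open)
    fix z assume "z \<in> interior S'" "V z = 0"
    then show "z = q" using S' V_zero by (simp add: interior_open)
  qed (rule Vq)
qed

section \<open>The rank condition and the error dynamics of the closed loop\<close>

lemma mat_rank_full_imp_inj:
  assumes "mat_rank m m A = m"
  shows "inj_matrix_on {..<m} A"
proof -
  let ?F = "{S. S \<subseteq> {..<m} \<and> lin_indep_cols m A S}"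
  have fin: "finite ?F" by (rule finite_subset[of _ "Pow {..<m}"]) auto
  have "{} \<in> ?F" by (simp add: lin_indep_cols_def)
  then have "Max (card ` ?F) \<in> card ` ?F" using fin by (intro Max_in) auto
  then obtain S where S: "S \<subseteq> {..<m}" "lin_indep_cols m A S" "card S = m"
    using assms by (auto simp: mat_rank_def)
  then have "S = {..<m}" by (intro card_subset_eq) auto
  then show ?thesis
    using S(2) by (simp add: lin_indep_cols_def inj_matrix_on_def mult.commute)
qed

text \<open>These are the columns of the matrix that \<open>u\<close> applies to the negative error.
  Splitting off the error makes \<open>u\<close> linear in it, with coefficients of which only
  continuity near the target is needed.\<close>

definition input_col :: "nat \<Rightarrow> (nat \<Rightarrow> nat) \<Rightarrow> (nat \<Rightarrow> real) \<Rightarrow> (nat \<Rightarrow> real^'n \<Rightarrow> real)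
     \<Rightarrow> (real^'n \<Rightarrow> nat \<Rightarrow> real^'n) \<Rightarrow> (real^'n \<Rightarrow> real^'n^'n)
     \<Rightarrow> (real^'n \<Rightarrow> nat \<Rightarrow> nat \<Rightarrow> real) \<Rightarrow> real^'n \<Rightarrow> nat \<Rightarrow> real^'n" where
  "input_col m blk kk psi Fq R L q j = matrix_inv (R q) *v
     (\<Sum>i<m. (\<Sum>k<m. CD blk Fq R q k i * L q k j * (psi (blk j) q * kk (blk j)))
        *\<^sub>R gs_hat (Jrow Fq R q) i)"

lemma ctrl_u_eq:
  "ctrl_u m blk kk psi p f Fq R L q = - (\<Sum>j<m. (f q j - p j) *\<^sub>R input_col m blk kk psi Fq R L q j)"
proof -
  let ?h = "gs_hat (Jrow Fq R q)"
  let ?a = "\<lambda>i k j. CD blk Fq R q k i * L q k j * (psi (blk j) q * kk (blk j))"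
  have "(\<Sum>i<m. (\<Sum>k<m. CD blk Fq R q k i * (\<Sum>j<m. L q k j * rprime blk kk psi p f q j)) *\<^sub>R ?h i)
      = (\<Sum>i<m. (\<Sum>j<m. (p j - f q j) * (\<Sum>k<m. ?a i k j)) *\<^sub>R ?h i)"
  proof (rule sum.cong[OF refl])
    fix i
    have "(\<Sum>k<m. CD blk Fq R q k i * (\<Sum>j<m. L q k j * rprime blk kk psi p f q j))
        = (\<Sum>k<m. \<Sum>j<m. (p j - f q j) * ?a i k j)"
      by (simp add: sum_distrib_left rprime_def mult_ac)
    also have "\<dots> = (\<Sum>j<m. (p j - f q j) * (\<Sum>k<m. ?a i k j))"
      by (subst sum.swap) (simp add: sum_distrib_left)
    finally show "(\<Sum>k<m. CD blk Fq R q k i * (\<Sum>j<m. L q k j * rprime blk kk psi p f q j)) *\<^sub>R ?h i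
        = (\<Sum>j<m. (p j - f q j) * (\<Sum>k<m. ?a i k j)) *\<^sub>R ?h i" by simp
  qed
  also have "\<dots> = (\<Sum>i<m. \<Sum>j<m. ((p j - f q j) * (\<Sum>k<m. ?a i k j)) *\<^sub>R ?h i)"
    by (simp only: scaleR_sum_left)
  also have "\<dots> = (\<Sum>j<m. \<Sum>i<m. ((p j - f q j) * (\<Sum>k<m. ?a i k j)) *\<^sub>R ?h i)"
    by (rule sum.swap)
  also have "\<dots> = (\<Sum>j<m. (p j - f q j) *\<^sub>R (\<Sum>i<m. (\<Sum>k<m. ?a i k j) *\<^sub>R ?h i))"
    by (simp add: scaleR_sum_right)
  finally have "ctrl_u m blk kk psi p f Fq R L q
      = matrix_inv (R q) *v (\<Sum>j<m. (p j - f q j) *\<^sub>R (\<Sum>i<m. (\<Sum>k<m. ?a i k j) *\<^sub>R ?h i))"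
    by (simp add: ctrl_u_def)
  also have "\<dots> = (\<Sum>j<m. (p j - f q j) *\<^sub>R input_col m blk kk psi Fq R L q j)"
    by (simp only: input_col_def linear_sum[OF matrix_vector_mul_linear] linear_cmul[OF matrix_vector_mul_linear])
  also have "\<dots> = - (\<Sum>j<m. (f q j - p j) *\<^sub>R input_col m blk kk psi Fq R L q j)"
    by (simp add: scaleR_diff_left flip: sum_negf)
  finally show ?thesis .
qed

text \<open>The inverse of \<open>R\<close> turns the Jacobian rows into rows of \<open>J\<close>,
  and \<open>gs_row_hat\<close> turns these into \<open>C\<close>. The result is the matrix
  \<open>M\<close> of the error dynamics.\<close>

lemma Fq_inner_input_col:
  "Fq q j \<bullet> input_col m blk kk psi Fq R L q k = (\<Sum>s<m. gs_c (Jrow Fq R q) j s *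
      (\<Sum>h<m. CD blk Fq R q h s * L q h k * (psi (blk k) q * kk (blk k))))"
  unfolding input_col_def dot_lmul_matrix[symmetric] Jrow_def[of Fq R q j, symmetric]
  by (simp add: inner_sum_right gs_row_hat mult.commute)

lemma Jrow_tendsto:
  assumes "isCont (\<lambda>q. Fq q i) z" "isCont R z" "\<And>q. invertible (R q)"
  shows "((\<lambda>q. Jrow Fq R q i) \<longlongrightarrow> Jrow Fq R z i) (at z)"
  unfolding Jrow_def
  by (intro tendsto_vector_matrix_mult tendsto_matrix_inv) (use assms in \<open>auto simp: isCont_def\<close>)

text \<open>In the coordinates \<open>R q *v h\<close>, the kernel of the Jacobian is the orthogonal
  complement of the rows of \<open>J\<close>, about which Gram-Schmidt gives information.\<close>

lemma Fq_inner_eq_Jrow: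
  assumes "invertible (R q)"
  shows "Fq q i \<bullet> h = Jrow Fq R q i \<bullet> (R q *v h)"
  unfolding Jrow_def dot_lmul_matrix
  by (simp add: matrix_vector_mul_assoc matrix_inv_mult(2)[OF assms])

theorem theorem22:
  fixes l m :: nat
    and blk :: "nat \<Rightarrow> nat"
    and kk :: "nat \<Rightarrow> real"
    and psi :: "nat \<Rightarrow> real^'n \<Rightarrow> real"
    and p :: "nat \<Rightarrow> real"
    and f :: "real^'n \<Rightarrow> nat \<Rightarrow> real"
    and Fq :: "real^'n \<Rightarrow> nat \<Rightarrow> real^'n"
    and R :: "real^'n \<Rightarrow> real^'n^'n"
    and L :: "real^'n \<Rightarrow> nat \<Rightarrow> nat \<Rightarrow> real"
    and qinf :: "real^'n"
  assumes l2: "l \<ge> 2"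
    and m_le_n: "m \<le> CARD('n)"
    and blk_mono: "\<forall>i j. i \<le> j \<longrightarrow> j < m \<longrightarrow> blk i \<le> blk j"
    and blk_onto: "blk ` {..<m} = {..<l}"
    and f_deriv: "\<forall>i<m. \<forall>q. ((\<lambda>x. f x i) has_derivative (\<lambda>h. Fq q i \<bullet> h)) (at q)"
    and Fq_cont: "\<forall>i<m. continuous_on UNIV (\<lambda>q. Fq q i)"
    and R_inv: "\<forall>q. invertible (R q)"
    and R_cont: "continuous_on UNIV R"
    and kk_pos: "\<forall>a<l. kk a > 0"
    and psi_cont: "\<forall>a<l. continuous_on UNIV (psi a)"
    and psi_range: "\<forall>a<l. \<forall>q. 0 \<le> psi a q \<and> psi a q \<le> 1"
    and L_lower: "\<forall>q i j. i < m \<longrightarrow> j < m \<longrightarrow> blk i < blk j \<longrightarrow> L q i j = 0"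
    and A4_sym: "\<forall>q i j. i < m \<longrightarrow> j < m \<longrightarrow> blk i = blk j \<longrightarrow> L q i j = L q j i"
    and A4_psd: "\<forall>q a (x::nat \<Rightarrow> real). a < l \<longrightarrow>
        0 \<le> (\<Sum>i\<in>{i. i < m \<and> blk i = a}. \<Sum>j\<in>{j. j < m \<and> blk j = a}. x i * L q i j * x j)"
    and A5: "\<forall>q i j. i < m \<longrightarrow> j < m \<longrightarrow> blk i = blk j \<longrightarrow>
        (\<Sum>h\<in>{h. h < m \<and> blk h = blk i}.
            (\<Sum>k\<in>{k. k < m \<and> blk k = blk i}. CD blk Fq R q i k * CD blk Fq R q h k) * L q h j)
      = (\<Sum>h\<in>{h. h < m \<and> blk h = blk i}.
            L q i h * (\<Sum>k\<in>{k. k < m \<and> blk k = blk i}. CD blk Fq R q h k * CD blk Fq R q j k))"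
    and L_cont: "\<forall>q. dim (span (Jrow Fq R q ` {..<m})) = m \<longrightarrow>
        (\<forall>i<m. \<forall>j<m. isCont (\<lambda>x. L x i j) q)"
    and f_qinf: "\<forall>i<m. f qinf i = p i"
    and rank_cond: "mat_rank m m
        (\<lambda>i j. \<Sum>k<m. CD blk Fq R qinf k i * L qinf k j * psi (blk j) qinf) = m"
  shows "semistable_eq (ctrl_u m blk kk psi p f Fq R L) qinf \<and>
    (m = CARD('n) \<longrightarrow> asymp_stable_eq (ctrl_u m blk kk psi p f Fq R L) qinf)"
proof -
  let ?I = "{..<m}"
  let ?J = "Jrow Fq R"
  let ?U = "input_col m blk kk psi Fq R L"
  let ?C = "gs_c (?J qinf)" and ?CD = "CD blk Fq R qinf" and ?L = "L qinf"
  define \<kappa> where "\<kappa> a = psi a qinf * kk a" for a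
  define A where "A i j = (\<Sum>k<m. ?CD k i * ?L k j * psi (blk j) qinf)" for i j
  have blk_l: "blk i < l" if "i < m" for i using blk_onto that by auto
  have A_inj: "inj_matrix_on ?I A"
    unfolding A_def[abs_def] using rank_cond by (rule mat_rank_full_imp_inj)
  \<comment> \<open>A vanishing \<open>psi\<close> would make column \<open>j\<close> of
    \<open>A\<close> zero, against injectivity.\<close>
  have psi_pos: "psi (blk j) qinf > 0" if j: "j < m" for j
  proof (rule ccontr)
    assume "\<not> psi (blk j) qinf > 0"
    then have 0: "psi (blk j) qinf = 0" using psi_range blk_l[OF j] by (meson antisym not_less)
    have "(\<Sum>k<m. A i k * (if k = j then 1 else 0)) = 0" for i
      by (rule sum.neutral) (use 0 in \<open>auto simp: A_def\<close>)
    then show False using inj_matrix_onD[OF A_inj, of "\<lambda>k. if k = j then 1 else 0" j] j by simp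
  qed
  \<comment> \<open>A vanishing pivot would make column \<open>i\<close> of \<open>?CD\<close>,
    hence row \<open>i\<close> of \<open>A\<close>, zero, against surjectivity.\<close>
  have c_pos: "gs_cdiag (?J qinf) i > 0" if i: "i < m" for i
  proof (rule ccontr)
    assume n: "\<not> gs_cdiag (?J qinf) i > 0"
    then have "gs_cdiag (?J qinf) i = 0" by (simp add: gs_cdiag_def)
    then have "?CD k i = 0" for k by (auto simp: CD_def gs_c_def)
    then have A0: "A i j = 0" for j by (simp add: A_def)
    obtain x where "\<forall>i\<in>?I. (\<Sum>j<m. A i j * x j) = 1"
      using inj_matrix_on_imp_surj[OF _ A_inj, of "\<lambda>_. 1"] by auto
    then have "(\<Sum>j<m. A i j * x j) = 1" using i by blast
    then show False by (simp add: A0)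
  qed
  \<comment> \<open>A kernel vector of \<open>?L\<close>, divided entrywise by the positive
    \<open>psi\<close>, is a kernel vector of \<open>A\<close>.\<close>
  have L_inj: "inj_matrix_on ?I ?L"
    unfolding inj_matrix_on_def
  proof (intro allI impI ballI)
    fix x j assume x: "\<forall>i\<in>?I. (\<Sum>j<m. ?L i j * x j) = 0" and j: "j \<in> ?I"
    let ?g = "\<lambda>j. x j / psi (blk j) qinf"
    have "(\<Sum>j<m. A i j * ?g j) = 0" for i
    proof -
      have "(\<Sum>j<m. A i j * ?g j) = (\<Sum>j<m. \<Sum>k<m. ?CD k i * (?L k j * x j))"
      proof (rule sum.cong[OF refl])
        fix j assume "j \<in> ?I"
        then have "psi (blk j) qinf \<noteq> 0" using psi_pos[of j] by simp
        then show "A i j * ?g j = (\<Sum>k<m. ?CD k i * (?L k j * x j))"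
          unfolding A_def sum_distrib_right by (intro sum.cong[OF refl]) simp
      qed
      also have "\<dots> = (\<Sum>k<m. ?CD k i * (\<Sum>j<m. ?L k j * x j))"
        by (subst sum.swap) (simp add: sum_distrib_left)
      also have "\<dots> = 0" using x by simp
      finally show ?thesis .
    qed
    then have "?g j = 0" using inj_matrix_onD[OF A_inj, of ?g j] j by blast
    then show "x j = 0" using psi_pos[of j] j by simp
  qed
  have "\<exists>P cP cM. (\<forall>i<m. \<forall>j<m. P i j = P j i) \<and>
      cP > 0 \<and> (\<forall>y. cP * (\<Sum>i<m. (y i)\<^sup>2) \<le> qform ?I P y) \<and>
      cM > 0 \<and> (\<forall>y. cM * (\<Sum>i<m. (y i)\<^sup>2)
        \<le> qform ?I (\<lambda>i k. \<Sum>j<m. P i j * (Fq qinf j \<bullet> ?U qinf k)) y)"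
  proof (rule block_triangular_lyapunov_matrix[where blk=blk and C="?C" and CD="?CD" and L="?L" and \<kappa>=\<kappa>])
    show "blk i \<le> blk j" if "i \<le> j" "j < m" for i j using blk_mono that by blast
    show "?C i k = 0" if "i < k" for i k using that by (rule gs_c_upper)
    show "?C i i > 0" if "i < m" for i using c_pos[OF that] by (simp add: gs_c_def)
    show "?CD i k = (if blk i = blk k then ?C i k else 0)" for i k by (simp add: CD_def)
    show "?L i j = 0" if "i < m" "j < m" "blk i < blk j" for i j using L_lower that by blast
    show "?L i j = ?L j i" if "i < m" "j < m" "blk i = blk j" for i j using A4_sym that by blast
    show "0 \<le> (\<Sum>i\<in>{i. i < m \<and> blk i = a}. \<Sum>j\<in>{j. j < m \<and> blk j = a}. x i * ?L i j * x j)"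
      if "a \<in> blk ` ?I" for a x
    proof -
      have "a < l" using that blk_onto by simp
      then show ?thesis using A4_psd by blast
    qed
    show "\<kappa> (blk i) > 0" if "i < m" for i
      using psi_pos[OF that] kk_pos blk_l[OF that] by (simp add: \<kappa>_def)
    show "Fq qinf j \<bullet> ?U qinf k = (\<Sum>s<m. ?C j s * (\<Sum>h<m. ?CD h s * ?L h k * \<kappa> (blk k)))" for j k
      by (simp add: Fq_inner_input_col \<kappa>_def)
  qed (rule L_inj)
  then obtain P cP cM where P0: "\<forall>i<m. \<forall>j<m. P i j = P j i"
    and cP: "cP > 0" "\<forall>y. cP * (\<Sum>i<m. (y i)\<^sup>2) \<le> qform ?I P y"
    and cM: "cM > 0" "\<forall>y. cM * (\<Sum>i<m. (y i)\<^sup>2)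
        \<le> qform ?I (\<lambda>i k. \<Sum>j<m. P i j * (Fq qinf j \<bullet> ?U qinf k)) y"
    by (elim exE conjE)
  have P: "P i j = P j i" if "i < m" "j < m" for i j using P0 that by blast
  have Fq_at: "isCont (\<lambda>q. Fq q i) z" if "i < m" for i z
    using Fq_cont that by (simp add: continuous_on_eq_continuous_at)
  have J_lim: "((\<lambda>q. ?J q i) \<longlongrightarrow> ?J z i) (at z)" if "i < m" for i z
    by (rule Jrow_tendsto) (use Fq_at[OF that] R_cont R_inv in \<open>auto simp: continuous_on_eq_continuous_at\<close>)
  \<comment> \<open>Positive pivots persist near the target; they give full rank at all nearby
    points, and with it continuity of \<open>L\<close> there.\<close>
  have "\<forall>\<^sub>F z in nhds qinf. \<forall>i\<in>?I. gs_cdiag (?J z) i > 0"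
  proof (rule eventually_ball_finite, simp, rule ballI)
    fix i assume i: "i \<in> ?I"
    have "isCont (\<lambda>z. gs_cdiag (?J z) i) qinf"
      unfolding isCont_def by (rule gs_cdiag_tendsto[of m]) (use J_lim c_pos i in auto)
    from isCont_tendsto_nhds[OF this] show "\<forall>\<^sub>F z in nhds qinf. gs_cdiag (?J z) i > 0"
      by (rule order_tendstoD) (use c_pos i in simp)
  qed
  then have U_cont: "\<forall>\<^sub>F z in nhds qinf. \<forall>j<m. isCont (\<lambda>z. ?U z j) z"
  proof eventually_elim
    case (elim z)
    then have pos: "gs_cdiag (?J z) i > 0" if "i < m" for i using that by simp
    have "dim (span (?J z ` ?I)) = m" by (rule dim_rows_eq) (rule pos)
    then have L_at: "isCont (\<lambda>x. L x i j) z" if "i < m" "j < m" for i j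
      using L_cont that by blast
    have psi_at: "isCont (psi (blk j)) z" if "j < m" for j
      using psi_cont blk_l[OF that] by (simp add: continuous_on_eq_continuous_at)
    have CD_lim: "((\<lambda>q. CD blk Fq R q k i) \<longlongrightarrow> CD blk Fq R z k i) (at z)" if "k < m" "i < m" for k i
      unfolding CD_def using gs_c_tendsto[OF J_lim pos that] by auto
    have hat_lim: "((\<lambda>q. gs_hat (?J q) i) \<longlongrightarrow> gs_hat (?J z) i) (at z)" if "i < m" for i
      by (rule gs_hat_tendsto[OF J_lim pos that])
    have R_lim: "((\<lambda>q. matrix_inv (R q)) \<longlongrightarrow> matrix_inv (R z)) (at z)"
      by (rule tendsto_matrix_inv) (use R_cont R_inv in \<open>auto simp: continuous_on_def\<close>)
    show ?case
    proof (intro allI impI)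
      fix j assume j: "j < m"
      show "isCont (\<lambda>z. ?U z j) z"
        unfolding isCont_def input_col_def
        by (intro tendsto_matrix_vector_mult R_lim tendsto_sum tendsto_scaleR tendsto_mult
            tendsto_const hat_lim CD_lim)
          (use L_at psi_at j in \<open>auto simp: isCont_def\<close>)
    qed
  qed
  have e_deriv: "((\<lambda>z. f z i - p i) has_derivative (\<lambda>h. Fq z i \<bullet> h)) (at z)" if "i < m" for z i
    using has_derivative_diff[OF f_deriv[rule_format, OF that] has_derivative_const] by simp
  have zero: "f qinf i - p i = 0" if "i < m" for i using f_qinf that by simp
  note stab = quadratic_lyapunov_stability[where
      u="ctrl_u m blk kk psi p f Fq R L" and q=qinf and m=m and cP=cP and cM=cM and e="\<lambda>z i. f z i - p i" and G=Fq and U="?U" and P=P,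
      OF ctrl_u_eq U_cont e_deriv Fq_at zero P cP(1) spec[OF cP(2)] cM(1) spec[OF cM(2)]]
  \<comment> \<open>For \<open>m = n\<close> the rows of \<open>J\<close> span the whole space, so a
    vector annihilated by all Jacobian rows has an image under \<open>R\<close> orthogonal to
    everything.\<close>
  have "h = 0" if mn: "m = CARD('n)" and h: "\<And>i. i < m \<Longrightarrow> Fq qinf i \<bullet> h = 0" for h
  proof -
    have "dim (span (?J qinf ` ?I)) = DIM(real^'n)"
      using dim_rows_eq[of m "?J qinf"] c_pos mn by simp
    then have full: "span (?J qinf ` ?I) = UNIV"
    by (simp add: dim_eq_full[symmetric])
    have "orthogonal (R qinf *v h) y" for y
    proof (rule orthogonal_to_span[of _ "?J qinf ` ?I"])
      show "y \<in> span (?J qinf ` ?I)" using full by simp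
      fix x assume "x \<in> ?J qinf ` ?I"
      then show "orthogonal (R qinf *v h) x"
        using h Fq_inner_eq_Jrow[of R qinf Fq _ h] R_inv by (auto simp: orthogonal_def inner_commute)
    qed
    then have "R qinf *v h = 0" by (simp flip: orthogonal_self)
    then have "matrix_inv (R qinf) *v (R qinf *v h) = 0" by simp
    then show "h = 0"
      using R_inv by (simp add: matrix_vector_mul_assoc matrix_inv_mult(2))
  qed
  then show ?thesis using stab by blast
qed

end
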